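(* Let $\mu>0$ and $\nu\in(0,1]$. The distribution $\tilde u^{2,\mu}_\nu(x,t)=\int_0^\infty\tilde g^2_\mu(x,s)\,l_\nu(s,t)\,ds$, $x>0$, $t>0$, solves the fractional equation $$\frac{\partial^\nu}{\partial t^\nu}\tilde u^{2,\mu}_\nu=\frac{1}{2^2}\left(\frac{\partial^2}{\partial x^2}-\frac{\partial}{\partial x}\frac{(2\mu-1)}{x}\right)\tilde u^{2,\mu}_\nu,\qquad x>0,\ t>0.$$
   Context: $\tilde g^2_\mu(x,s)=2\,\frac{x^{2\mu-1}}{s^{\mu}\Gamma(\mu)}e^{-x^2/s}$, $x,s>0$. The term $\frac{\partial}{\partial x}\frac{(2\mu-1)}{x}$ acts on $f$ as $\frac{\partial}{\partial x}\big(\frac{2\mu-1}{x}f\big)$. For $\nu\in(0,1)$, $h_\nu(\cdot,t)$ is the density of the $\nu$-stable subordinator $\tilde\tau^{(\nu)}_t$ (non-decreasing Lévy process with $E\exp\{-\lambda\tilde\tau^{(\nu)}_t\}=\exp\{-t\lambda^\nu\}$, $\lambda>0$), $L^{(\nu)}_t$ is its inverse process, $\Pr\{L^{(\nu)}_t<x\}=\Pr\{\tilde\tau^{(\nu)}_x>t\}$, and $l_\nu(x,t)=\int_t^\infty\frac{\partial}{\partial x}h_\nu(s,x)\,ds$ is the density of $L^{(\nu)}_t$. For $\nu=1$, $L^{(1)}_t=t$, so $l_1(s,t)\,ds$ is the unit point mass at $s=t$ and $\tilde u^{2,\mu}_1=\tilde g^2_\mu$. $\frac{\partial^\nu}{\partial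 t^\nu}$ is the Dzerbayshan–Caputo fractional derivative: for $0<\nu<1$, $\frac{d^\nu}{dt^\nu}f(t)=\frac{1}{\Gamma(1-\nu)}\int_0^t(t-s)^{-\nu}f'(s)\,ds$; for $\nu=1$ it is the ordinary derivative. *)

theory Defs
  imports "HOL-Probability.Probability"
begin

text \<open>Processes are indexed by \<^typ>\<open>real\<close>; only times \<open>t \<ge> 0\<close> matter.\<close>

definition levy_process :: "'a measure \<Rightarrow> (real \<Rightarrow> 'a \<Rightarrow> real) \<Rightarrow> bool" where
  "levy_process M X \<longleftrightarrow>
     prob_space M \<and>
     (\<forall>t\<ge>0. X t \<in> borel_measurable M) \<and>
     (AE \<omega> in M. X 0 \<omega> = 0) \<and>
     (\<forall>(n::nat) (t :: nat \<Rightarrow> real). 0 \<le> t 0 \<and> mono t \<longrightarrow>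
        prob_space.indep_vars M (\<lambda>_. borel) (\<lambda>i \<omega>. X (t (Suc i)) \<omega> - X (t i) \<omega>) {..<n}) \<and>
     (\<forall>s\<ge>0. \<forall>t\<ge>0. distr M borel (\<lambda>\<omega>. X (s + t) \<omega> - X s \<omega>) = distr M borel (X t)) \<and>
     (AE \<omega> in M. (\<forall>t\<ge>0. ((\<lambda>s. X s \<omega>) \<longlongrightarrow> X t \<omega>) (at_right t)) \<and>
                 (\<forall>t>0. \<exists>l. ((\<lambda>s. X s \<omega>) \<longlongrightarrow> l) (at_left t)))"

definition stable_subordinator :: "real \<Rightarrow> 'a measure \<Rightarrow> (real \<Rightarrow> 'a \<Rightarrow> real) \<Rightarrow> bool" where
  "stable_subordinator \<nu> M \<tau> \<longleftrightarrow>
     levy_process M \<tau> \<and>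
     (AE \<omega> in M. mono_on {0..} (\<lambda>t. \<tau> t \<omega>)) \<and>
     (\<forall>t\<ge>0. \<forall>r>0. integral\<^sup>L M (\<lambda>\<omega>. exp (- r * \<tau> t \<omega>)) = exp (- t * r powr \<nu>))"

text \<open>\<open>h s t\<close> is the density of \<open>X t\<close> at \<open>s\<close>. A density is determined only up to null sets, separately
  for each \<open>t\<close>, so a derivative in \<open>t\<close> at fixed \<open>s\<close> makes sense only for a distinguished version;
  continuity in \<open>s\<close> determines \<open>h s t\<close> uniquely for \<open>s > 0\<close>, \<open>t > 0\<close>.\<close>

definition continuous_density_of ::
    "'a measure \<Rightarrow> (real \<Rightarrow> 'a \<Rightarrow> real) \<Rightarrow> (real \<Rightarrow> real \<Rightarrow> real) \<Rightarrow> bool" where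
  "continuous_density_of M X h \<longleftrightarrow>
     (\<forall>t>0. (\<forall>s. 0 \<le> h s t) \<and> continuous_on {0<..} (\<lambda>s. h s t) \<and>
            distributed M lborel (X t) (\<lambda>s. ennreal (h s t)))"

text \<open>The density at \<open>x\<close> of the inverse process \<open>L\<close> at time \<open>t\<close>: since \<open>L t < x\<close> and \<open>X x > t\<close> have the
  same probability, it is the \<open>x\<close>-derivative of the integral of \<open>h s x\<close> over \<open>s > t\<close>.\<close>

definition inverse_density :: "(real \<Rightarrow> real \<Rightarrow> real) \<Rightarrow> real \<Rightarrow> real \<Rightarrow> real" where
  "inverse_density h x t = (LBINT s:{t<..}. deriv (\<lambda>y. h s y) x)"

definition g_tilde :: "real \<Rightarrow> real \<Rightarrow> real \<Rightarrow> real" where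
  "g_tilde \<mu> x s = 2 * (x powr (2 * \<mu> - 1) / (s powr \<mu> * Gamma \<mu>)) * exp (- (x ^ 2) / s)"

text \<open>For \<open>\<nu> = 1\<close> the inverse process is \<open>L t = t\<close>, whose law is the point mass at \<open>t\<close>.\<close>

definition u_tilde :: "real \<Rightarrow> real \<Rightarrow> (real \<Rightarrow> real \<Rightarrow> real) \<Rightarrow> real \<Rightarrow> real \<Rightarrow> real" where
  "u_tilde \<mu> \<nu> h x t =
     (if \<nu> = 1 then integral\<^sup>L (return borel t) (\<lambda>s. g_tilde \<mu> x s)
      else (LBINT s:{0<..}. g_tilde \<mu> x s * inverse_density h s t))"

definition caputo_deriv :: "real \<Rightarrow> (real \<Rightarrow> real) \<Rightarrow> real \<Rightarrow> real" where
  "caputo_deriv \<nu> f t =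
     (if \<nu> = 1 then deriv f t
      else 1 / Gamma (1 - \<nu>) * (LBINT s:{0<..<t}. (t - s) powr (- \<nu>) * deriv f s))"

text \<open>Existence of the derivative above; the library's \<^const>\<open>deriv\<close> and Lebesgue integral are total.\<close>

definition caputo_differentiable :: "real \<Rightarrow> (real \<Rightarrow> real) \<Rightarrow> real \<Rightarrow> bool" where
  "caputo_differentiable \<nu> f t \<longleftrightarrow>
     (if \<nu> = 1 then f differentiable (at t)
      else (\<forall>s\<in>{0<..<t}. f differentiable (at s)) \<and>
           set_integrable lborel {0<..<t} (\<lambda>s. (t - s) powr (- \<nu>) * deriv f s))"

definition solves_fractional_equation :: "real \<Rightarrow> real \<Rightarrow> (real \<Rightarrow> real \<Rightarrow> real) \<Rightarrow> bool" where
  "solves_fractional_equation \<mu> \<nu> u \<longleftrightarrow>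
     (\<forall>x>0. \<forall>t>0.
        caputo_differentiable \<nu> (\<lambda>r. u x r) t \<and>
        (\<lambda>y. u y t) differentiable (at x) \<and>
        deriv (\<lambda>y. u y t) differentiable (at x) \<and>
        caputo_deriv \<nu> (\<lambda>r. u x r) t =
          1 / 2 ^ 2 * (deriv (deriv (\<lambda>y. u y t)) x - deriv (\<lambda>y. (2 * \<mu> - 1) / y * u y t) x))"

end

(*  For 0 < nu < 1 the density of the stable subordinator is found by Laplace inversion along a ray of
    argument theta > pi/2 with nu theta < pi/2: it is h(s,x) = P(x s^-nu) / s with P smooth and P(0) = 0.
    Hence s h(s,x) depends on x s^-nu only, so l_nu(x,t) = P(x t^-nu) / (nu x), and
      u(x,t) = (1/nu) * int_0^oo g(x, z t^nu) / z * P(z) dz,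
    which may be differentiated under the integral because P >= 0 is integrable and g(x,s) vanishes to
    infinite order at s = 0. As g satisfies d/ds g = 1/4 (d^2/dx^2 - d/dx (2 mu - 1)/x) g, it remains to see
    that the Caputo derivative in t turns g(x,.) into its s-derivative; this is an identity between
    integrals of one function against two measures on the half line whose moments, computed from Beta and
    Gamma integrals, agree and determine them.  *)
theory Submission
  imports Defs "HOL-Complex_Analysis.Complex_Analysis" "HOL-Real_Asymp.Real_Asymp"
begin

lemma has_real_derivative_integral:
  fixes f f' :: "real \<Rightarrow> 'a \<Rightarrow> real"
  assumes x0: "x0 \<in> {a<..<b}"
    and int: "\<And>x. x \<in> {a<..<b} \<Longrightarrow> integrable M (f x)"
    and der: "\<And>x w. x \<in> {a<..<b} \<Longrightarrow> w \<in> space M \<Longrightarrow> ((\<lambda>x. f x w) has_real_derivative f' x w) (at x)"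
    and bnd: "\<And>x w. x \<in> {a<..<b} \<Longrightarrow> w \<in> space M \<Longrightarrow> \<bar>f' x w\<bar> \<le> B w"
    and B: "integrable M B"
  shows "integrable M (f' x0)" (is ?I)
    and "((\<lambda>x. \<integral>w. f x w \<partial>M) has_real_derivative (\<integral>w. f' x0 w \<partial>M)) (at x0)" (is ?D)
proof -
  have lim: "integrable M (f' x0) \<and>
      (\<lambda>n. ((\<integral>w. f (X n) w \<partial>M) - (\<integral>w. f x0 w \<partial>M)) / (X n - x0)) \<longlonglongrightarrow> (\<integral>w. f' x0 w \<partial>M)"
    if X: "\<And>n. X n \<noteq> x0" "X \<longlonglongrightarrow> x0" "\<And>n. X n \<in> {a<..<b}" for X :: "nat \<Rightarrow> real"
  proof -
    define q where "q = (\<lambda>n w. (f (X n) w - f x0 w) / (X n - x0))"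
    have qm: "q n \<in> borel_measurable M" for n
      unfolding q_def using int[OF X(3)[of n]] int[OF x0] by measurable
    have qlim: "(\<lambda>n. q n w) \<longlonglongrightarrow> f' x0 w" if "w \<in> space M" for w
    proof -
      have "((\<lambda>x. (f x w - f x0 w) / (x - x0)) \<longlongrightarrow> f' x0 w) (at x0)"
        using der[OF x0 that] by (simp add: has_field_derivative_iff)
      moreover have "filterlim X (at x0) sequentially"
        using X by (simp add: filterlim_at)
      ultimately show ?thesis unfolding q_def by (rule filterlim_compose)
    qed
    have qb: "\<bar>q n w\<bar> \<le> B w" if w: "w \<in> space M" for n w
    proof -
      have "\<exists>z\<in>{a<..<b}. f (X n) w - f x0 w = (X n - x0) * f' z w"
      proof (cases "X n < x0")
        case True
        have "\<exists>z. X n < z \<and> z < x0 \<and> f x0 w - f (X n) w = (x0 - X n) * f' z w"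
          by (rule MVT2[OF True]) (use der[OF _ w] X(3)[of n] x0 in auto)
        then obtain z where "X n < z" "z < x0" "f x0 w - f (X n) w = (x0 - X n) * f' z w" by blast
        then show ?thesis using X(3)[of n] x0 
          by (intro bexI[of _ z]) (auto simp: algebra_simps)
      next
        case False
        then have l: "x0 < X n" using X(1)[of n] by linarith
        have "\<exists>z. x0 < z \<and> z < X n \<and> f (X n) w - f x0 w = (X n - x0) * f' z w"
          by (rule MVT2[OF l]) (use der[OF _ w] X(3)[of n] x0 in auto)
        then show ?thesis using X(3)[of n] x0 by auto
      qed
      then show ?thesis using X(1)[of n] bnd[OF _ w] by (fastforce simp: q_def)
    qed
    have m': "f' x0 \<in> borel_measurable M"
      by (rule borel_measurable_LIMSEQ_real[OF qlim qm])
    have i': "integrable M (f' x0)"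
      by (rule Bochner_Integration.integrable_bound[OF B m']) (use bnd[OF x0] in force)
    have "(\<lambda>n. \<integral>w. q n w \<partial>M) \<longlonglongrightarrow> (\<integral>w. f' x0 w \<partial>M)"
      by (rule integral_dominated_convergence[where w = B, OF m' qm B]) (use qlim qb in auto)
    moreover have "(\<integral>w. q n w \<partial>M) = ((\<integral>w. f (X n) w \<partial>M) - (\<integral>w. f x0 w \<partial>M)) / (X n - x0)" for n
      unfolding q_def using int[OF X(3)[of n]] int[OF x0] by simp
    ultimately show ?thesis using i' by simp
  qed
  define d where "d = (b - x0) / 2"
  have d: "d > 0" "x0 + d < b" using x0 by (auto simp: d_def field_simps)
  have seq: "(\<lambda>n. x0 + d / real (Suc n)) \<longlonglongrightarrow> x0"
    using LIMSEQ_inverse_real_of_nat[THEN tendsto_mult_left, of d] tendsto_add[OF tendsto_const[of x0]]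
    by (force simp: divide_inverse)
  have "d / real (Suc n) \<le> d" for n using d by (simp add: divide_le_eq_1 field_simps)
  then have in_ab: "x0 + d / real (Suc n) \<in> {a<..<b}" for n using d x0 
    by (smt (verit) greaterThanLessThan_iff of_nat_0_less_iff zero_less_Suc zero_less_divide_iff)
  show ?I using lim[OF _ seq in_ab] d by simp
  show ?D unfolding has_field_derivative_iff
  proof (subst tendsto_at_iff_sequentially, safe)
    fix X :: "nat \<Rightarrow> real" assume X: "\<forall>i. X i \<in> UNIV - {x0}" "X \<longlonglongrightarrow> x0"
    have "eventually (\<lambda>n. X n \<in> {a<..<b}) sequentially"
      using X(2) x0 by (intro topological_tendstoD) auto
    then obtain N where N: "\<And>n. n \<ge> N \<Longrightarrow> X n \<in> {a<..<b}" by (auto simp: eventually_sequentially)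
    have "(\<lambda>n. ((\<integral>w. f (X (n + N)) w \<partial>M) - (\<integral>w. f x0 w \<partial>M)) / (X (n + N) - x0)) \<longlonglongrightarrow> (\<integral>w. f' x0 w \<partial>M)"
      by (rule lim[THEN conjunct2]) (use X N LIMSEQ_ignore_initial_segment[OF X(2)] in auto)
    then show "((\<lambda>x. ((\<integral>w. f x w \<partial>M) - (\<integral>w. f x0 w \<partial>M)) / (x - x0)) \<circ> X) \<longlonglongrightarrow> (\<integral>w. f' x0 w \<partial>M)"
      unfolding o_def by (rule LIMSEQ_offset)
  qed
qed

lemma integral_continuous_eqI:
  fixes f1 Y1 :: "'a \<Rightarrow> real" and f2 Y2 :: "'b \<Rightarrow> real" and \<Phi> :: "real \<Rightarrow> real"
  assumes f: "integrable M1 f1" "integrable M2 f2"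
    and Ym [measurable]: "Y1 \<in> borel_measurable M1" "Y2 \<in> borel_measurable M2"
    and Y1: "\<And>x. x \<in> space M1 \<Longrightarrow> Y1 x \<in> {0..1}" and Y2: "\<And>x. x \<in> space M2 \<Longrightarrow> Y2 x \<in> {0..1}"
    and moments: "\<And>n. (\<integral>x. Y1 x ^ n * f1 x \<partial>M1) = (\<integral>x. Y2 x ^ n * f2 x \<partial>M2)"
    and cont: "continuous_on {0..1} \<Phi>"
  shows "integrable M1 (\<lambda>x. \<Phi> (Y1 x) * f1 x)" "integrable M2 (\<lambda>x. \<Phi> (Y2 x) * f2 x)"
    and "(\<integral>x. \<Phi> (Y1 x) * f1 x \<partial>M1) = (\<integral>x. \<Phi> (Y2 x) * f2 x \<partial>M2)"
proof -
  have "compact (\<Phi> ` {0..1})" by (intro compact_continuous_image cont) auto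
  then obtain C where C: "\<And>y. y \<in> {0..1} \<Longrightarrow> \<bar>\<Phi> y\<bar> \<le> C"
    by (metis (full_types) bounded_iff compact_imp_bounded image_eqI real_norm_def)
  have int: "integrable M (\<lambda>x. \<phi> (Y x) * f x)"
    if f: "integrable M f" and [measurable]: "Y \<in> borel_measurable M" and Y: "\<And>x. x \<in> space M \<Longrightarrow> Y x \<in> {0..1}"
      and c: "continuous_on {0..1} \<phi>" for M :: "'c measure" and f Y :: "'c \<Rightarrow> real" and \<phi> :: "real \<Rightarrow> real"
  proof -
    have "compact (\<phi> ` {0..1})" by (intro compact_continuous_image c) auto
    then obtain C where C: "\<And>y. y \<in> {0..1::real} \<Longrightarrow> \<bar>\<phi> y\<bar> \<le> C"
      by (metis (full_types) bounded_iff compact_imp_bounded image_eqI real_norm_def)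
    have "(\<lambda>y. indicator {0..1} y * \<phi> y) \<in> borel_measurable borel"
      using borel_measurable_continuous_on_indicator[OF _ c] by simp
    then have "(\<lambda>x. (indicator {0..1} (Y x) * \<phi> (Y x)) * f x) \<in> borel_measurable M"
      using f by measurable
    then have m: "(\<lambda>x. \<phi> (Y x) * f x) \<in> borel_measurable M"
      by (rule measurable_cong[THEN iffD1, rotated]) (use Y in auto)
    show ?thesis
    proof (rule Bochner_Integration.integrable_bound[OF _ m])
      show "integrable M (\<lambda>x. C * \<bar>f x\<bar>)" using f by simp
      show "AE x in M. norm (\<phi> (Y x) * f x) \<le> norm (C * \<bar>f x\<bar>)"
        using C[OF Y] by (intro AE_I2) (simp add: abs_mult mult_right_mono order.trans[OF _ abs_ge_self])
    qed
  qed
  note i1 = int[OF f(1) Ym(1) Y1] and i2 = int[OF f(2) Ym(2) Y2]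
  show "integrable M1 (\<lambda>x. \<Phi> (Y1 x) * f1 x)" "integrable M2 (\<lambda>x. \<Phi> (Y2 x) * f2 x)"
    using i1[OF _ cont] i2[OF _ cont] by auto
  define K where "K = (\<integral>x. \<bar>f1 x\<bar> \<partial>M1) + (\<integral>x. \<bar>f2 x\<bar> \<partial>M2)"
  have K: "K \<ge> 0" unfolding K_def by simp
  have close: "\<bar>(\<integral>x. \<Phi> (Y1 x) * f1 x \<partial>M1) - (\<integral>x. \<Phi> (Y2 x) * f2 x \<partial>M2)\<bar> \<le> e * K" if e: "e > 0" for e
  proof -
    obtain g where g: "real_polynomial_function g" "\<And>x. x \<in> {0..1} \<Longrightarrow> \<bar>\<Phi> x - g x\<bar> < e"
      by (rule Stone_Weierstrass_real_polynomial_function[OF _ cont e]) auto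
    obtain a n where gs: "g = (\<lambda>x. \<Sum>i\<le>n. a i * x ^ i)"
      using g(1) by (auto simp: real_polynomial_function_iff_sum)
    have gc: "continuous_on {0..1} g" unfolding gs by (intro continuous_intros)
    have pc: "continuous_on {0..1} (\<lambda>x::real. x ^ i)" for i by (intro continuous_intros)
    have "(\<integral>x. g (Y1 x) * f1 x \<partial>M1) = (\<Sum>i\<le>n. a i * (\<integral>x. Y1 x ^ i * f1 x \<partial>M1))"
      unfolding gs using i1[OF _ pc]
      by (simp add: sum_distrib_right mult.assoc)
    also have "\<dots> = (\<Sum>i\<le>n. a i * (\<integral>x. Y2 x ^ i * f2 x \<partial>M2))" by (simp add: moments)
    also have "\<dots> = (\<integral>x. g (Y2 x) * f2 x \<partial>M2)"
      unfolding gs using i2[OF _ pc]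
      by (simp add: sum_distrib_right mult.assoc)
    finally have eq: "(\<integral>x. g (Y1 x) * f1 x \<partial>M1) = (\<integral>x. g (Y2 x) * f2 x \<partial>M2)" .
    have d: "\<bar>(\<integral>x. \<Phi> (Y x) * f x \<partial>M) - (\<integral>x. g (Y x) * f x \<partial>M)\<bar> \<le> e * (\<integral>x. \<bar>f x\<bar> \<partial>M)"
      if f: "integrable M f" and Ym: "Y \<in> borel_measurable M" and Y: "\<And>x. x \<in> space M \<Longrightarrow> Y x \<in> {0..1}"
      for M :: "'c measure" and f Y :: "'c \<Rightarrow> real"
    proof -
      note i = int[OF f Ym Y]
      have "(\<integral>x. \<Phi> (Y x) * f x \<partial>M) - (\<integral>x. g (Y x) * f x \<partial>M) = (\<integral>x. (\<Phi> (Y x) - g (Y x)) * f x \<partial>M)"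
        using i[OF _ cont] i[OF _ gc] by (simp add: left_diff_distrib)
      also have "\<bar>\<dots>\<bar> \<le> (\<integral>x. \<bar>(\<Phi> (Y x) - g (Y x)) * f x\<bar> \<partial>M)"
        using integral_norm_bound[of M "\<lambda>x. (\<Phi> (Y x) - g (Y x)) * f x"] by simp
      also have "\<dots> \<le> (\<integral>x. e * \<bar>f x\<bar> \<partial>M)"
      proof (rule integral_mono)
        show "integrable M (\<lambda>x. \<bar>(\<Phi> (Y x) - g (Y x)) * f x\<bar>)"
          using i[OF _ continuous_on_diff[OF cont gc]] by simp
        show "\<bar>(\<Phi> (Y x) - g (Y x)) * f x\<bar> \<le> e * \<bar>f x\<bar>" if "x \<in> space M" for x
          unfolding abs_mult using g(2)[OF Y[OF that]] by (intro mult_right_mono) auto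
      qed (use f in simp)
      finally show ?thesis by simp
    qed
    have "\<bar>(\<integral>x. \<Phi> (Y1 x) * f1 x \<partial>M1) - (\<integral>x. g (Y1 x) * f1 x \<partial>M1)\<bar> \<le> e * (\<integral>x. \<bar>f1 x\<bar> \<partial>M1)"
      by (rule d) (use f Ym Y1 in auto)
    moreover have "\<bar>(\<integral>x. \<Phi> (Y2 x) * f2 x \<partial>M2) - (\<integral>x. g (Y2 x) * f2 x \<partial>M2)\<bar> \<le> e * (\<integral>x. \<bar>f2 x\<bar> \<partial>M2)"
      by (rule d) (use f Ym Y2 in auto)
    ultimately show ?thesis unfolding K_def using eq by (simp add: ring_distribs)
  qed
  show "(\<integral>x. \<Phi> (Y1 x) * f1 x \<partial>M1) = (\<integral>x. \<Phi> (Y2 x) * f2 x \<partial>M2)"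
  proof (rule ccontr)
    define D where "D = \<bar>(\<integral>x. \<Phi> (Y1 x) * f1 x \<partial>M1) - (\<integral>x. \<Phi> (Y2 x) * f2 x \<partial>M2)\<bar>"
    assume "\<not> ?thesis"
    then have "D > 0" by (simp add: D_def)
    then have "D \<le> D / (2 * (K + 1)) * K" using close[of "D / (2 * (K + 1))"] K by (simp add: D_def)
    also have "\<dots> < D" using \<open>D > 0\<close> K by (simp add: field_simps add_nonneg_pos)
    finally show False by simp
  qed
qed

section \<open>Uniqueness from Laplace transforms and from moments\<close>

lemma continuous_zero_of_laplace_zero:
  fixes f :: "real \<Rightarrow> real"
  assumes cont: "continuous_on {0<..} f"
    and int: "set_integrable lborel {0<..} (\<lambda>s. exp (- s) * f s)"
    and zero: "\<And>n::nat. (LBINT s:{0<..}. exp (- (real n + 1) * s) * f s) = 0"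
    and s0: "s0 > 0"
  shows "f s0 = 0"
proof (rule ccontr)
  assume nz: "f s0 \<noteq> 0"
  define g where "g s = sgn (f s0) * f s" for s
  have g0: "g s0 > 0" using nz by (simp add: g_def sgn_if)
  have gc: "continuous_on {0<..} g" unfolding g_def by (intro continuous_intros cont)
  have "isCont g s0" using gc s0 by (simp add: continuous_on_eq_continuous_at)
  then have "eventually (\<lambda>s. g s > 0) (at s0)"
    using g0 by (simp add: isCont_def order_tendstoD)
  then obtain e where e: "e > 0" "\<And>s. s \<noteq> s0 \<Longrightarrow> dist s s0 < e \<Longrightarrow> g s > 0"
    by (auto simp: eventually_at)
  define d where "d = min (e / 2) (s0 / 2)"
  have d: "d > 0" "d < e" "d < s0" using e(1) s0 by (auto simp: d_def)
  have gpos: "g s > 0" if "\<bar>s - s0\<bar> \<le> d" for s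
    using that e(2)[of s] g0 d by (cases "s = s0") (auto simp: dist_real_def)
  define y1 y2 where "y1 = exp (- (s0 + d))" and "y2 = exp (- (s0 - d))"
  define \<Phi> where "\<Phi> y = max 0 ((y - y1) * (y2 - y))" for y :: real
  define F where "F s = indicator {0<..} s * (exp (- s) * f s)" for s
  have F: "integrable lborel F"
    using int by (simp add: F_def[abs_def] set_integrable_def)
  define Y :: "real \<Rightarrow> real" where "Y s = exp (- max 0 s)" for s
  have Ym: "Y \<in> borel_measurable lborel" unfolding Y_def by measurable
  have mom: "(\<integral>s. Y s ^ n * F s \<partial>lborel) = (\<integral>s. Y s ^ n * 0 \<partial>lborel)" for n
  proof -
    have "(\<integral>s. Y s ^ n * F s \<partial>lborel) = (LBINT s:{0<..}. exp (- (real n + 1) * s) * f s)"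
      unfolding set_lebesgue_integral_def
      by (intro Bochner_Integration.integral_cong refl)
        (auto simp: F_def Y_def indicator_def exp_add exp_of_nat_mult exp_of_nat2_mult ring_distribs exp_minus exp_diff field_simps)
    then show ?thesis using zero[of n] by simp
  qed
  have "integrable lborel (\<lambda>s. \<Phi> (Y s) * F s)" "(\<integral>s. \<Phi> (Y s) * F s \<partial>lborel) = (\<integral>s. \<Phi> (Y s) * 0 \<partial>(lborel::real measure))"
    by (rule integral_continuous_eqI[OF F _ Ym Ym _ _ mom], 
        (force simp: Y_def \<Phi>_def intro!: continuous_intros)+)+
  then have int\<Phi>: "integrable lborel (\<lambda>s. \<Phi> (Y s) * F s)" and zero\<Phi>: "(\<integral>s. \<Phi> (Y s) * F s \<partial>lborel) = 0"
    by simp_all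
  define G where "G s = sgn (f s0) * (\<Phi> (Y s) * F s)" for s
  have Gpos: "G s > 0" if "\<bar>s - s0\<bar> < d" for s
  proof -
    have "s > 0" using that d by auto
    moreover have "\<Phi> (exp (- s)) > 0" using that
      by (auto simp: \<Phi>_def y1_def y2_def less_max_iff_disj)
    moreover have "g s > 0" using gpos that by auto
    ultimately have "\<Phi> (exp (- s)) * exp (- s) * g s > 0" by simp
    then show ?thesis using \<open>s > 0\<close> by (simp add: G_def F_def Y_def g_def mult_ac)
  qed
  have Gnn: "G s \<ge> 0" for s
  proof (cases "\<bar>s - s0\<bar> < d")
    case True then show ?thesis using Gpos by (auto intro: less_imp_le)
  next
    case False
    then have "s0 + d \<le> s \<or> s \<le> s0 - d" by linarith
    then have "(exp (- s) - y1) * (y2 - exp (- s)) \<le> 0"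
    proof
      assume "s0 + d \<le> s"
      then show ?thesis using d unfolding y1_def y2_def by (intro mult_nonpos_nonneg) auto
    next
      assume "s \<le> s0 - d"
      then show ?thesis using d unfolding y1_def y2_def by (intro mult_nonneg_nonpos) auto
    qed
    then have "s > 0 \<Longrightarrow> \<Phi> (Y s) = 0" by (simp add: \<Phi>_def Y_def)
    then show ?thesis by (cases "s > 0") (auto simp: G_def F_def)
  qed
  have "AE s in lborel. G s = 0"
  proof (rule integral_nonneg_eq_0_iff_AE[THEN iffD1])
    show "integrable lborel G" "(\<integral>s. G s \<partial>lborel) = 0" unfolding G_def using int\<Phi> zero\<Phi> by auto
  qed (use Gnn in auto)
  then have "AE s in lborel. s \<notin> {s0 - d<..<s0 + d}"
  proof eventually_elim
    case (elim s)
    then show ?case using Gpos[of s] by (auto simp: abs_less_iff)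
  qed
  then have "emeasure lborel {s0 - d<..<s0 + d} = 0"
    by (subst (asm) AE_iff_measurable[OF _ refl]) (auto simp: greaterThanLessThan_eq greaterThan_def lessThan_def Collect_conj_eq[symmetric])
  then show False using d by simp
qed

lemma exp_series_integral:
  fixes f Z :: "'a \<Rightarrow> real"
  assumes f: "\<And>x. x \<in> space M \<Longrightarrow> f x \<ge> 0" and Z: "\<And>x. x \<in> space M \<Longrightarrow> Z x \<ge> 0"
    and mom: "\<And>n. has_bochner_integral M (\<lambda>x. Z x ^ n * f x) (m n)"
    and summ: "summable (\<lambda>n. p ^ n / fact n * m n)" and p: "p \<ge> 0"
  shows "(\<integral>x. exp (- p * Z x) * f x \<partial>M) = (\<Sum>n. (- p) ^ n / fact n * m n)"
proof -
  have i: "integrable M (\<lambda>x. (- p) ^ n / fact n * (Z x ^ n * f x))" for n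
    using mom[of n] by (auto simp: has_bochner_integral_iff)
  have "(\<integral>x. (\<Sum>n. (- p) ^ n / fact n * (Z x ^ n * f x)) \<partial>M) = (\<Sum>n. \<integral>x. (- p) ^ n / fact n * (Z x ^ n * f x) \<partial>M)"
  proof (rule integral_suminf[OF i])
    have nrm: "norm ((- p) ^ n / fact n * (Z x ^ n * f x)) = p ^ n / fact n * (Z x ^ n * f x)" if "x \<in> space M" for x n
      using f[OF that] Z[OF that] p by (simp add: abs_mult power_abs)
    show "AE x in M. summable (\<lambda>n. norm ((- p) ^ n / fact n * (Z x ^ n * f x)))"
    proof (rule AE_I2)
      fix x assume x: "x \<in> space M"
      have "summable (\<lambda>n. (p * Z x) ^ n /\<^sub>R fact n * f x)"
        by (intro summable_mult2 summable_exp_generic)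
      then show "summable (\<lambda>n. norm ((- p) ^ n / fact n * (Z x ^ n * f x)))"
        unfolding nrm[OF x] by (simp add: field_simps power_mult_distrib)
    qed
    have "(\<integral>x. norm ((- p) ^ n / fact n * (Z x ^ n * f x)) \<partial>M) = p ^ n / fact n * m n" for n
    proof -
      have "(\<integral>x. norm ((- p) ^ n / fact n * (Z x ^ n * f x)) \<partial>M) = (\<integral>x. p ^ n / fact n * (Z x ^ n * f x) \<partial>M)"
        by (intro Bochner_Integration.integral_cong refl nrm)
      then show ?thesis using mom[of n] by (simp add: has_bochner_integral_iff)
    qed
    then show "summable (\<lambda>n. \<integral>x. norm ((- p) ^ n / fact n * (Z x ^ n * f x)) \<partial>M)" using summ by simp
  qed
  moreover have "(\<Sum>n. (- p) ^ n / fact n * (Z x ^ n * f x)) = exp (- p * Z x) * f x" for x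
  proof -
    have "(\<lambda>n. (- p * Z x) ^ n /\<^sub>R fact n * f x) sums (exp (- p * Z x) * f x)"
      by (intro sums_mult2 exp_converges)
    then show ?thesis by (simp add: sums_iff field_simps power_mult_distrib power_minus')
  qed
  ultimately show ?thesis using mom by (simp add: has_bochner_integral_iff)
qed

lemma integral_eq_of_moments_eq:
  fixes f1 Z1 :: "'a \<Rightarrow> real" and f2 Z2 :: "'b \<Rightarrow> real" and \<psi> :: "real \<Rightarrow> real"
  assumes f1: "\<And>x. x \<in> space M1 \<Longrightarrow> f1 x \<ge> 0" and Z1: "\<And>x. x \<in> space M1 \<Longrightarrow> Z1 x \<ge> 0"
    and f2: "\<And>x. x \<in> space M2 \<Longrightarrow> f2 x \<ge> 0" and Z2: "\<And>x. x \<in> space M2 \<Longrightarrow> Z2 x \<ge> 0"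
    and Zm [measurable]: "Z1 \<in> borel_measurable M1" "Z2 \<in> borel_measurable M2"
    and mom1: "\<And>n. has_bochner_integral M1 (\<lambda>x. Z1 x ^ n * f1 x) (m n)"
    and mom2: "\<And>n. has_bochner_integral M2 (\<lambda>x. Z2 x ^ n * f2 x) (m n)"
    and summ: "\<And>p. p \<ge> 0 \<Longrightarrow> summable (\<lambda>n. p ^ n / fact n * m n)"
    and cont: "continuous_on {0..} \<psi>" and lim: "(\<psi> \<longlongrightarrow> 0) at_top"
  shows "integrable M1 (\<lambda>x. \<psi> (Z1 x) * f1 x)" "integrable M2 (\<lambda>x. \<psi> (Z2 x) * f2 x)"
    and "(\<integral>x. \<psi> (Z1 x) * f1 x \<partial>M1) = (\<integral>x. \<psi> (Z2 x) * f2 x \<partial>M2)"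
proof -
  define \<Phi> where "\<Phi> y = (if y = 0 then 0 else \<psi> (- ln y))" for y :: real
  have c: "continuous_on {0..1} \<Phi>"
    unfolding continuous_on_eq_continuous_within
  proof
    fix y :: real assume y: "y \<in> {0..1}"
    show "continuous (at y within {0..1}) \<Phi>"
    proof (cases "y = 0")
      case False
      have "continuous_on {0<..1} (\<lambda>y. \<psi> (- ln y))"
        by (rule continuous_on_compose2[OF cont]) (auto intro!: continuous_intros)
      then have "continuous_on {0<..1} \<Phi>"
        by (rule continuous_on_cong[THEN iffD1, rotated 2]) (auto simp: \<Phi>_def)
      then have "continuous (at y within {0<..1}) \<Phi>" using y False
        by (auto simp: continuous_on_eq_continuous_within)
      moreover have "at y within {0<..1} = at y within {0..1}"
        using y False by (intro at_within_nhd[of _ "{0<..}"]) auto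
      ultimately show ?thesis by simp
    next
      case True
      have "filterlim (\<lambda>y::real. - ln y) at_top (at_right 0)" by real_asymp
      then have "((\<lambda>y. \<psi> (- ln y)) \<longlongrightarrow> 0) (at_right 0)"
        by (rule filterlim_compose[OF lim])
      then have "(\<Phi> \<longlongrightarrow> 0) (at_right 0)"
        by (rule tendsto_cong[THEN iffD1, rotated]) (auto simp: eventually_at_filter \<Phi>_def)
      then have "(\<Phi> \<longlongrightarrow> 0) (at 0 within {0..1})"
        by (simp add: at_within_Icc_at_right)
      then show ?thesis using True by (simp add: continuous_within \<Phi>_def)
    qed
  qed
  have f: "integrable M1 f1" "integrable M2 f2"
    using mom1[of 0] mom2[of 0] by (auto simp: has_bochner_integral_iff)
  have Y: "(\<lambda>x. exp (- Z1 x)) \<in> borel_measurable M1" "(\<lambda>x. exp (- Z2 x)) \<in> borel_measurable M2"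
    by measurable
  have e: "(\<integral>x. exp (- Z1 x) ^ n * f1 x \<partial>M1) = (\<integral>x. exp (- Z2 x) ^ n * f2 x \<partial>M2)" for n
  proof -
    note exp_series_integral[OF f1 Z1 mom1 summ, of "real n"] exp_series_integral[OF f2 Z2 mom2 summ, of "real n"]
    then show ?thesis by (simp add: exp_of_nat_mult[symmetric])
  qed
  have "integrable M1 (\<lambda>x. \<Phi> (exp (- Z1 x)) * f1 x)" "integrable M2 (\<lambda>x. \<Phi> (exp (- Z2 x)) * f2 x)"
    "(\<integral>x. \<Phi> (exp (- Z1 x)) * f1 x \<partial>M1) = (\<integral>x. \<Phi> (exp (- Z2 x)) * f2 x \<partial>M2)"
    by (rule integral_continuous_eqI[OF f Y _ _ e c]; use Z1 Z2 in simp)+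
  then show "integrable M1 (\<lambda>x. \<psi> (Z1 x) * f1 x)" "integrable M2 (\<lambda>x. \<psi> (Z2 x) * f2 x)"
    "(\<integral>x. \<psi> (Z1 x) * f1 x \<partial>M1) = (\<integral>x. \<psi> (Z2 x) * f2 x \<partial>M2)"
    by (simp_all add: \<Phi>_def)
qed

section \<open>Laplace inversion of the stretched exponential\<close>

lemma integrable_inverse_cosh:
  fixes c :: real assumes "c > 0"
  shows "integrable lborel (\<lambda>p. 1 / (exp (c * p) + exp (- c * p)))"
proof -
  have "set_integrable lborel (einterval (-\<infinity>) \<infinity>) (\<lambda>p. c / (exp (c * p) + exp (- c * p)))"
  proof (rule interval_integral_FTC_nonneg)
    show "((\<lambda>p. arctan (exp (c * p))) has_real_derivative c / (exp (c * p) + exp (- c * p))) (at p)" for p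
      by (auto intro!: derivative_eq_intros simp: exp_minus divide_simps add_pos_pos exp_add[symmetric] power2_eq_square)
    show "isCont (\<lambda>p. c / (exp (c * p) + exp (- c * p))) p" for p
      by (intro continuous_intros) (metis add_pos_pos exp_gt_zero less_irrefl)
    show "(((\<lambda>p. arctan (exp (c * p))) \<circ> real_of_ereal) \<longlongrightarrow> 0) (at_right (- \<infinity>))"
      unfolding ereal_tendsto_simps using assms by real_asymp
    show "(((\<lambda>p. arctan (exp (c * p))) \<circ> real_of_ereal) \<longlongrightarrow> pi / 2) (at_left \<infinity>)"
      unfolding ereal_tendsto_simps using assms by real_asymp
  qed (use assms in \<open>auto intro!: divide_nonneg_pos add_pos_pos\<close>)
  then have "integrable lborel (\<lambda>p. (1 / c) * (c / (exp (c * p) + exp (- c * p))))"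
    by (intro integrable_mult_right) (simp add: set_integrable_def einterval_eq_UNIV)
  then show ?thesis using assms by simp
qed

lemma le_exp: "x \<le> exp (x :: real)"
  using exp_ge_add_one_self[of x] by linarith

locale stable_index =
  fixes \<nu> :: real
  assumes nu_pos: "0 < \<nu>" and nu_less_1: "\<nu> < 1"
begin

text \<open>This angle exceeds \<open>\<pi>/2\<close> while \<open>\<nu>\<close> times it stays below \<open>\<pi>/2\<close>: along the ray with this
  argument both \<open>exp (s z)\<close> and \<open>exp (- x z\<^sup>\<nu>)\<close> decay. Rays are parametrised by \<open>z = exp (p + \<i> \<theta>)\<close>, so that
  scaling \<open>z\<close> becomes translating \<open>p\<close> and powers of \<open>z\<close> need no branch.\<close>

definition \<theta> :: real where "\<theta> = pi / (1 + \<nu>)"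
definition a :: real where "a = cos (\<nu> * \<theta>)"
definition E1 :: "real \<Rightarrow> complex" where "E1 p = exp (Complex p \<theta>)"
definition E2 :: "real \<Rightarrow> complex" where "E2 p = exp (of_real \<nu> * Complex p \<theta>)"

lemma theta_bounds: "pi / 2 < \<theta>" "\<theta> < pi" "0 < \<theta>" "0 < \<nu> * \<theta>" "\<nu> * \<theta> < pi / 2"
  using nu_pos nu_less_1 by (auto simp: \<theta>_def field_simps)

lemma nu_theta: "\<nu> * \<theta> = pi - \<theta>"
  using nu_pos by (simp add: \<theta>_def field_simps add_nonneg_eq_0_iff)

lemma cos_theta: "cos \<theta> = - a"
  by (simp add: a_def nu_theta)

lemma sin_theta_pos: "sin \<theta> > 0"
  using theta_bounds by (intro sin_gt_zero)

lemma a_pos: "a > 0"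
  unfolding a_def using theta_bounds by (intro cos_gt_zero) auto

lemma E_simps [simp]:
  "Re (E1 p) = - (a * exp p)" "Im (E1 p) = exp p * sin \<theta>" "norm (E1 p) = exp p"
  "Re (E2 p) = a * exp (\<nu> * p)" "norm (E2 p) = exp (\<nu> * p)"
  by (simp_all add: E1_def E2_def Re_exp Im_exp cos_theta a_def)

lemma E1_nz: "E1 p \<noteq> 0" "1 - E1 p \<noteq> 0" "1 + E1 p \<noteq> 0"
proof -
  have "Im (1 - E1 p) \<noteq> 0" "Im (1 + E1 p) \<noteq> 0" using sin_theta_pos by auto
  then show "1 - E1 p \<noteq> 0" "1 + E1 p \<noteq> 0" by force+
qed (simp add: E1_def)

lemma E_continuous [continuous_intros]: "continuous_on A E1" "continuous_on A E2"
  unfolding E1_def[abs_def] E2_def[abs_def] Complex_eq by (intro continuous_intros)+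

lemma E_measurable [measurable]: "E1 \<in> borel_measurable borel" "E2 \<in> borel_measurable borel"
  by (intro borel_measurable_continuous_onI continuous_intros)+

lemma E_add: "E1 (p + q) = exp q * E1 p" "E2 (p + q) = exp (\<nu> * q) * E2 p"
  by (auto simp: E1_def E2_def exp_add[symmetric] Complex_eq exp_of_real[symmetric] algebra_simps)

lemma integrable_kernel:
  fixes x l :: real
  assumes "x > 0" "l > 0"
  shows "integrable lborel (\<lambda>p. exp p * exp (- (x * a * exp (\<nu> * p))) / (l + a * exp p))"
proof (rule Bochner_Integration.integrable_bound)
  define K where "K = 1 / (a * (x * a)) + (1 / l + 1 / a)"
  show "integrable lborel (\<lambda>p. K * (1 / (exp (\<nu> * p) + exp (- \<nu> * p))))"
    by (intro integrable_mult_right integrable_inverse_cosh nu_pos)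
  show "AE p in lborel. norm (exp p * exp (- (x * a * exp (\<nu> * p))) / (l + a * exp p))
      \<le> norm (K * (1 / (exp (\<nu> * p) + exp (- \<nu> * p))))"
  proof (rule AE_I2)
    fix p :: real
    let ?y = "exp (\<nu> * p)" let ?e = "exp (- (x * a * exp (\<nu> * p)))"
    let ?k = "exp p * ?e / (l + a * exp p)"
    have pos: "l + a * exp p > 0" using a_pos assms by (simp add: add_pos_pos)
    have K: "K > 0" using a_pos assms by (simp add: K_def add_pos_pos)
    have e1: "?e * ?y \<le> 1 / (x * a)"
    proof -
      have "x * a * ?y \<le> exp (x * a * ?y)" by (rule le_exp)
      then show ?thesis using assms a_pos by (simp add: exp_minus field_simps)
    qed
    have e2: "exp p / (l + a * exp p) \<le> 1 / a" using a_pos assms pos by (simp add: field_simps)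
    have e3: "exp p * exp (- \<nu> * p) / (l + a * exp p) \<le> 1 / l + 1 / a"
    proof -
      have "exp p * exp (- \<nu> * p) \<le> 1 + exp p"
      proof (cases "p \<ge> 0")
        case True
        then have "exp p * exp (- \<nu> * p) \<le> exp p * 1" using nu_pos by (intro mult_left_mono) auto
        then show ?thesis by linarith
      next
        case False
        then have "exp ((1 - \<nu>) * p) \<le> 1" using nu_less_1 by (simp add: mult_le_0_iff)
        then show ?thesis by (simp add: exp_add[symmetric] algebra_simps add_increasing2)
      qed
      also have "\<dots> \<le> (1 / l + 1 / a) * (l + a * exp p)"
        using a_pos assms by (simp add: field_simps add_pos_pos)
      finally show ?thesis using pos by (simp add: pos_divide_le_eq)
    qed
    have "?k * (?y + exp (- \<nu> * p)) = (exp p / (l + a * exp p)) * (?e * ?y) + ?e * (exp p * exp (- \<nu> * p) / (l + a * exp p))"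
      by (simp add: algebra_simps add_divide_distrib)
    also have "\<dots> \<le> (1 / a) * (1 / (x * a)) + 1 * (1 / l + 1 / a)"
      using e1 e2 e3 pos a_pos assms by (intro add_mono mult_mono) (auto intro!: divide_nonneg_nonneg)
    also have "\<dots> = K" by (simp add: K_def)
    finally have "?k \<le> K * (1 / (?y + exp (- \<nu> * p)))"
      by (simp add: pos_le_divide_eq add_pos_pos)
    then show "norm ?k \<le> norm (K * (1 / (?y + exp (- \<nu> * p))))"
      using pos K by simp
  qed
qed measurable

lemma one_minus_E1_ge: "norm (of_real l - E1 p) \<ge> l + a * exp p"
  using complex_Re_le_cmod[of "of_real l - E1 p"] by simp

text \<open>Subtracting a multiple of \<open>2 / ((1 + z) (1 - z))\<close> cancels the pole at \<open>z = 1\<close>. What remains is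
  holomorphic for \<open>\<bar>Im (ln z)\<bar> < \<pi>\<close> and real on the real axis, so shifting the line of integration shows that
  the imaginary part of its integral vanishes; the subtracted term integrates to an arctangent.\<close>

lemma cauchy_kernel_integral:
  fixes x :: real
  assumes x: "x > 0"
  shows "integrable lborel (\<lambda>p. Im (exp (- x * E2 p) * E1 p / (1 - E1 p)))"
    and "(\<integral>p. Im (exp (- x * E2 p) * E1 p / (1 - E1 p)) \<partial>lborel) = pi * exp (- x)"
proof -
  define f where "f p = Im (exp (- x * E2 p) * E1 p / (1 - E1 p))" for p
  define G :: "complex \<Rightarrow> complex" where "G z = exp (- x * exp (\<nu> * z))" for z :: complex
  define N :: "complex \<Rightarrow> complex" where "N z = exp z * (G z - G 0 * 2 / (1 + exp z))" for z
  define D :: "complex \<Rightarrow> complex" where "D z = 1 - exp z" for z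
  define S where "S = {z. - pi < Im z \<and> Im z < pi}"
  have S: "open S" "convex S"
  proof -
    have "S = {z. - pi < Im z} \<inter> {z. Im z < pi}" by (auto simp: S_def)
    then show "open S" "convex S"
      by (auto intro!: open_Int convex_Int open_halfspace_Im_gt open_halfspace_Im_lt convex_halfspace_Im_gt convex_halfspace_Im_lt)
  qed
  have exp1: "exp z = 1 \<longleftrightarrow> z = 0" if "z \<in> S" for z
  proof
    assume "exp z = 1"
    then obtain n :: int where n: "Re z = 0" "Im z = of_int (2 * n) * pi" by (auto simp: exp_eq_1)
    then have "\<bar>of_int (2 * n) * pi\<bar> < pi" using that by (auto simp: S_def abs_less_iff)
    then have "\<bar>of_int (2 * n) :: real\<bar> < 1" by (simp add: abs_mult)
    then have "n = 0" by linarith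
    then show "z = 0" using n by (simp add: complex_eq_iff)
  qed simp
  have exp_m1: "1 + exp z \<noteq> 0" if "z \<in> S" for z
  proof
    assume "1 + exp z = 0"
    then have "exp z = exp (\<i> * pi)" by (simp add: add_eq_0_iff)
    then have "\<exists>n::int. Im z = (1 + of_int (2 * n)) * pi"
      unfolding exp_eq by (auto simp: algebra_simps)
    then obtain n :: int where n: "Im z = (1 + of_int (2 * n)) * pi" by blast
    then have "\<bar>(1 + of_int (2 * n)) * pi\<bar> < pi" using that by (auto simp: S_def abs_less_iff)
    then have "\<bar>1 + of_int (2 * n) :: real\<bar> < 1" by (simp add: abs_mult)
    then have "real_of_int n < real_of_int 0" "real_of_int (- 1) < real_of_int n" by (simp_all add: abs_less_iff)
    then have "n < 0" "- 1 < n" by (simp_all only: of_int_less_iff)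
    then show False by linarith
  qed
  have S0: "0 \<in> S" by (simp add: S_def)
  have N0: "N 0 = 0" "D 0 = 0" by (simp_all add: N_def D_def)
  define Np where "Np z = (if z = 0 then deriv N 0 else (N z - N 0) / (z - 0))" for z
  define Dp where "Dp z = (if z = 0 then deriv D 0 else (D z - D 0) / (z - 0))" for z
  define \<Psi> where "\<Psi> z = Np z / Dp z" for z
  have "N holomorphic_on S" unfolding N_def G_def using exp_m1 by (intro holomorphic_intros) auto
  then have hN: "Np holomorphic_on S" unfolding Np_def by (rule pole_lemma_open) (rule S)
  have "D holomorphic_on S" unfolding D_def by (intro holomorphic_intros)
  then have hD: "Dp holomorphic_on S" unfolding Dp_def by (rule pole_lemma_open) (rule S)
  have "(D has_field_derivative - 1) (at 0)" unfolding D_def by (auto intro!: derivative_eq_intros)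
  then have Dp0: "Dp 0 = - 1" by (simp add: Dp_def DERIV_imp_deriv)
  have Dpnz: "Dp z \<noteq> 0" if "z \<in> S" for z
    using exp1[OF that] Dp0 by (cases "z = 0") (auto simp: Dp_def D_def)
  have h\<Psi>: "\<Psi> holomorphic_on S" unfolding \<Psi>_def using Dpnz by (intro holomorphic_intros hN hD) auto
  have \<Psi>_eq: "\<Psi> z = N z / D z" if "z \<noteq> 0" for z
    using that N0 by (simp add: \<Psi>_def Np_def Dp_def)
  obtain A where "\<And>z. z \<in> S \<Longrightarrow> (A has_field_derivative \<Psi> z) (at z within S)"
    using holomorphic_convex_primitive'[OF S(2,1) h\<Psi>] by blast
  then have A: "(A has_field_derivative \<Psi> z) (at z)" if "z \<in> S" for z
    using that S(1) by (metis at_within_open)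
  have real_in_S: "of_real p \<in> S" for p by (simp add: S_def)
  have Im\<Psi>_nz: "Im (\<Psi> (of_real p)) = 0" if "p \<noteq> 0" for p
  proof -
    have "\<Psi> (of_real p) = of_real (exp p * (exp (- x * exp (\<nu> * p)) - exp (- x) * 2 / (1 + exp p)) / (1 - exp p))"
      using that by (simp add: \<Psi>_eq N_def D_def G_def exp_of_real[symmetric])
    then show ?thesis by (metis Im_complex_of_real)
  qed
  have Im\<Psi>: "Im (\<Psi> (of_real p)) = 0" for p
  proof (cases "p = 0")
    case True
    have c: "isCont \<Psi> 0"
      using h\<Psi> S S0 by (metis continuous_on_eq_continuous_at holomorphic_on_imp_continuous_on)
    have "((\<lambda>p. Im (\<Psi> (of_real p))) \<longlongrightarrow> Im (\<Psi> 0)) (at (0::real))"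
    proof (intro tendsto_Im)
      have "isCont (\<lambda>p::real. \<Psi> (of_real p)) 0"
        by (rule continuous_at_compose[of 0 of_real \<Psi>, unfolded o_def]) (use c in auto)
      then show "((\<lambda>p::real. \<Psi> (of_real p)) \<longlongrightarrow> \<Psi> 0) (at 0)" by (simp add: isCont_def)
    qed
    moreover have "((\<lambda>p. Im (\<Psi> (of_real p))) \<longlongrightarrow> 0) (at (0::real))"
      by (rule tendsto_eventually) (auto simp: eventually_at_filter Im\<Psi>_nz)
    ultimately show ?thesis using True by (auto dest: tendsto_unique[rotated])
  qed (rule Im\<Psi>_nz)
  have dA: "((\<lambda>p. Im (A (Complex p y))) has_real_derivative Im (\<Psi> (Complex p y))) (at p)"
    if y: "\<bar>y\<bar> < pi" for p y
  proof -
    have "(A has_field_derivative \<Psi> (Complex p y)) (at (Complex p y))"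
      using y by (intro A) (auto simp: S_def)
    moreover have "((\<lambda>p. Complex p y) has_vector_derivative 1) (at p)"
      unfolding Complex_eq by (auto intro!: derivative_eq_intros)
    ultimately have "((A \<circ> (\<lambda>p. Complex p y)) has_vector_derivative (1 * \<Psi> (Complex p y))) (at p)"
      by (intro field_vector_diff_chain_at)
    then have "((\<lambda>p. Im (A (Complex p y))) has_vector_derivative Im (\<Psi> (Complex p y))) (at p)"
      unfolding o_def by (auto dest!: bounded_linear.has_vector_derivative[OF bounded_linear_Im])
    then show ?thesis by (simp add: has_real_derivative_iff_has_vector_derivative)
  qed
  define c where "c = Im (A 0)"
  have ImA: "Im (A (Complex p 0)) = c" for p
  proof -
    have "((\<lambda>p. Im (A (Complex p 0))) has_real_derivative 0) (at p)" for p
      using dA[of 0 p] Im\<Psi>[of p] by (simp add: complex_of_real_def)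
    then have "Im (A (Complex p 0)) = Im (A (Complex 0 0))"
      using DERIV_isconst_all[of "\<lambda>p. Im (A (Complex p 0))" p 0] by blast
    then show ?thesis by (simp add: c_def zero_complex.code)
  qed
  define Bd where "Bd p = exp p / \<bar>exp p - 1\<bar> * (exp (- x * (a * exp (\<nu> * p))) + 2 / \<bar>exp p - 1\<bar>)" for p :: real
  have \<Psi>_bound: "norm (\<Psi> (Complex p y)) \<le> Bd p" if y: "0 \<le> y" "y \<le> \<theta>" and p: "p \<noteq> 0" for p y
  proof -
    let ?z = "Complex p y"
    have cosy: "cos (\<nu> * y) \<ge> a"
      unfolding a_def using y theta_bounds nu_pos by (intro cos_monotone_0_pi_le) (auto intro!: mult_left_mono)
    have nG: "norm (G ?z) \<le> exp (- x * (a * exp (\<nu> * p)))"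
      using cosy x by (simp add: G_def Re_exp mult.commute)
    have "exp (- x) \<le> 1" using x by simp
    then have nG0: "norm (G 0) \<le> 1" using x by (simp add: G_def flip: exp_of_real of_real_minus)
    have n1: "\<bar>exp p - 1\<bar> \<le> norm (1 - exp ?z)"
      using norm_triangle_ineq3[of "exp ?z" 1] by (simp add: norm_minus_commute)
    have n2: "\<bar>exp p - 1\<bar> \<le> norm (1 + exp ?z)"
      using norm_triangle_ineq3[of "exp ?z" "-1"] by (simp add: add.commute)
    have q: "\<bar>exp p - 1\<bar> > 0" using p by simp
    have nz: "?z \<noteq> 0" using p by (auto simp: complex_eq_iff)
    have "norm (\<Psi> ?z) = exp p * norm (G ?z - G 0 * 2 / (1 + exp ?z)) / norm (1 - exp ?z)"
      using nz by (simp add: \<Psi>_eq N_def D_def norm_mult norm_divide)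
    also have "\<dots> \<le> exp p * (norm (G ?z) + norm (G 0) * 2 / norm (1 + exp ?z)) / norm (1 - exp ?z)"
      using norm_triangle_ineq4[of "G ?z" "G 0 * 2 / (1 + exp ?z)"]
      by (intro divide_right_mono mult_left_mono) (auto simp: norm_mult norm_divide)
    also have "\<dots> \<le> exp p * (exp (- x * (a * exp (\<nu> * p))) + 1 * 2 / \<bar>exp p - 1\<bar>) / \<bar>exp p - 1\<bar>"
      using nG nG0 n1 n2 q by (intro frac_le mult_left_mono add_mono mult_right_mono) auto
    finally show ?thesis by (simp add: Bd_def)
  qed
  have A_close: "\<bar>Im (A (Complex p \<theta>)) - c\<bar> \<le> Bd p * \<theta>" if p: "p \<noteq> 0" for p
  proof -
    let ?T = "{z. Re z = p \<and> 0 \<le> Im z \<and> Im z \<le> \<theta>}"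
    have "?T = {z. Re z \<le> p} \<inter> {z. Re z \<ge> p} \<inter> {z. Im z \<ge> 0} \<inter> {z. Im z \<le> \<theta>}" by auto
    then have cv: "convex ?T"
      by (simp add: convex_Int convex_halfspace_Im_ge convex_halfspace_Im_le convex_halfspace_Re_le convex_halfspace_Re_ge)
    have "norm (A (Complex p \<theta>) - A (Complex p 0)) \<le> Bd p * norm (Complex p \<theta> - Complex p 0)"
    proof (rule field_differentiable_bound[OF cv])
      fix z assume z: "z \<in> ?T"
      then have "z \<in> S" using theta_bounds by (simp add: S_def)
      then show "(A has_field_derivative \<Psi> z) (at z within ?T)"
        by (rule has_field_derivative_at_within[OF A])
      have "Complex p (Im z) = z" using z by (simp add: complex_eq_iff)
      then show "norm (\<Psi> z) \<le> Bd p" using \<Psi>_bound[of "Im z" p] z p by simp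
    qed (use theta_bounds in auto)
    moreover have "norm (Complex p \<theta> - Complex p 0) = \<theta>"
    proof -
      have "Complex p \<theta> - Complex p 0 = Complex 0 \<theta>" by (simp add: complex_eq_iff)
      then show ?thesis using theta_bounds by (simp add: complex_norm)
    qed
    ultimately show ?thesis
      using abs_Im_le_cmod[of "A (Complex p \<theta>) - A (Complex p 0)"] ImA[of p] by simp
  qed
  have Bd_top: "((\<lambda>p. Bd p * \<theta>) \<longlongrightarrow> 0) at_top" and Bd_bot: "((\<lambda>p. Bd p * \<theta>) \<longlongrightarrow> 0) at_bot"
    unfolding Bd_def using x a_pos nu_pos by real_asymp+
  have A_top: "((\<lambda>p. Im (A (Complex p \<theta>))) \<longlongrightarrow> c) at_top"
  proof (rule Lim_transform[OF tendsto_const])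
    show "((\<lambda>p. Im (A (Complex p \<theta>)) - c) \<longlongrightarrow> 0) at_top"
      by (rule Lim_null_comparison[OF eventually_mono[OF eventually_gt_at_top[of 0]] Bd_top])
        (use A_close in auto)
  qed
  have A_bot: "((\<lambda>p. Im (A (Complex p \<theta>))) \<longlongrightarrow> c) at_bot"
  proof (rule Lim_transform[OF tendsto_const])
    show "((\<lambda>p. Im (A (Complex p \<theta>)) - c) \<longlongrightarrow> 0) at_bot"
      by (rule Lim_null_comparison[OF eventually_mono[OF eventually_gt_at_bot[of 0]] Bd_bot])
        (use A_close in auto)
  qed
  define T where "T p = Im (A (Complex p \<theta>)) + exp (- x) * arctan ((exp p - exp (- p)) / (2 * sin \<theta>))" for p
  have dT: "(T has_real_derivative f p) (at p)" for p
  proof -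
    let ?e = "exp p" let ?m = "exp (- p)" let ?s = "sin \<theta>"
    define z where "z = inverse (E1 p) - E1 p"
    have "inverse (E1 p) = exp (- Complex p \<theta>)" by (simp add: E1_def exp_minus)
    then have z: "Re z = (?m - ?e) * cos \<theta>" "Im z = - (?m + ?e) * ?s"
      by (simp_all add: z_def Re_exp Im_exp cos_theta algebra_simps)
    have "2 * E1 p / ((1 + E1 p) * (1 - E1 p)) = 2 / z"
      using E1_nz[of p] by (simp add: z_def field_simps)
    moreover have "Im (2 / z) = 2 * (?m + ?e) * ?s / ((?m - ?e)\<^sup>2 + 4 * ?s\<^sup>2)"
    proof -
      have "(Re z)\<^sup>2 + (Im z)\<^sup>2 = (?m - ?e)\<^sup>2 * (cos \<theta>)\<^sup>2 + (?m + ?e)\<^sup>2 * ?s\<^sup>2"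
        unfolding z by (simp add: power2_eq_square algebra_simps)
      also have "\<dots> = (?m - ?e)\<^sup>2 + ((?m + ?e)\<^sup>2 - (?m - ?e)\<^sup>2) * ?s\<^sup>2"
        by (simp add: cos_squared_eq algebra_simps)
      also have "(?m + ?e)\<^sup>2 - (?m - ?e)\<^sup>2 = 4"
        by (simp add: power2_eq_square algebra_simps exp_add[symmetric])
      finally have sq: "(Re z)\<^sup>2 + (Im z)\<^sup>2 = (?m - ?e)\<^sup>2 + 4 * ?s\<^sup>2" .
      have "Im (2 / z) = (- 2 * Im z) / ((Re z)\<^sup>2 + (Im z)\<^sup>2)"
        by (simp add: Im_divide power2_eq_square)
      also have "\<dots> = 2 * (?m + ?e) * ?s / ((?m - ?e)\<^sup>2 + 4 * ?s\<^sup>2)"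
      proof -
        have "- 2 * Im z = 2 * (?m + ?e) * ?s" unfolding z(2) by (simp add: algebra_simps)
        then show ?thesis by (simp only: sq)
      qed
      finally show ?thesis .
    qed
    ultimately have k: "Im (2 * E1 p / ((1 + E1 p) * (1 - E1 p))) = 2 * (?m + ?e) * ?s / ((?m - ?e)\<^sup>2 + 4 * ?s\<^sup>2)"
      by simp
    have d1: "((\<lambda>p. arctan ((exp p - exp (- p)) / (2 * ?s))) has_real_derivative
        2 * (?m + ?e) * ?s / ((?m - ?e)\<^sup>2 + 4 * ?s\<^sup>2)) (at p)"
    proof -
      define D' where "D' = (?m - ?e)\<^sup>2 + 4 * ?s\<^sup>2"
      have nz: "D' > 0" using sin_theta_pos by (simp add: D'_def add_nonneg_pos)
      have eq: "1 + ((?e - ?m) / (2 * ?s))\<^sup>2 = D' / (4 * ?s\<^sup>2)"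
        using sin_theta_pos by (simp add: D'_def field_simps power2_eq_square)
      have "((\<lambda>p. (exp p - exp (- p)) / (2 * ?s)) has_real_derivative (?e + ?m) / (2 * ?s)) (at p)"
        by (rule DERIV_cdivide) (auto intro!: derivative_eq_intros)
      from DERIV_chain2[OF DERIV_arctan this]
      have "((\<lambda>p. arctan ((exp p - exp (- p)) / (2 * ?s))) has_real_derivative
          inverse (D' / (4 * ?s\<^sup>2)) * ((?e + ?m) / (2 * ?s))) (at p)" unfolding eq .
      moreover have "inverse (D' / (4 * ?s\<^sup>2)) * ((?e + ?m) / (2 * ?s)) = 2 * (?m + ?e) * ?s / D'"
        using nz sin_theta_pos by (simp add: field_simps power2_eq_square)
      ultimately show ?thesis unfolding D'_def by simp
    qed
    have zz: "Complex p \<theta> \<noteq> 0" using theta_bounds by (auto simp: complex_eq_iff)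
    have imr: "Im (of_real r * w) = r * Im w" for r w by simp
    have ex: "exp (- of_real x) = complex_of_real (exp (- x))" by (simp flip: exp_of_real)
    have "\<Psi> (Complex p \<theta>) = exp (- x * E2 p) * E1 p / (1 - E1 p) - exp (- x) * (2 * E1 p / ((1 + E1 p) * (1 - E1 p)))"
      unfolding \<Psi>_eq[OF zz] N_def D_def G_def E1_def[symmetric] E2_def[symmetric]
      by (simp add: right_diff_distrib diff_divide_distrib mult_ac ex)
    then have "Im (\<Psi> (Complex p \<theta>)) = f p - exp (- x) * Im (2 * E1 p / ((1 + E1 p) * (1 - E1 p)))"
      by (simp only: f_def minus_complex.sel imr)
    then have fp: "f p = Im (\<Psi> (Complex p \<theta>)) + exp (- x) * (2 * (?m + ?e) * ?s / ((?m - ?e)\<^sup>2 + 4 * ?s\<^sup>2))"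
      unfolding k by simp
    show ?thesis unfolding fp T_def using theta_bounds
      by (intro DERIV_add DERIV_cmult d1 dA) auto
  qed
  have T_top: "(T \<longlongrightarrow> c + exp (- x) * (pi / 2)) at_top"
    unfolding T_def using sin_theta_pos
    by (intro tendsto_intros A_top) real_asymp
  have T_bot: "(T \<longlongrightarrow> c + exp (- x) * (- (pi / 2))) at_bot"
    unfolding T_def using sin_theta_pos
    by (intro tendsto_intros A_bot) real_asymp
  have intf: "integrable lborel f"
  proof (rule Bochner_Integration.integrable_bound[OF integrable_kernel[OF x, of 1]])
    show "f \<in> borel_measurable lborel" unfolding f_def by measurable
    show "AE p in lborel. norm (f p) \<le> norm (exp p * exp (- (x * a * exp (\<nu> * p))) / (1 + a * exp p))"
    proof (rule AE_I2)
      fix p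
      have "norm (f p) \<le> norm (exp (- x * E2 p) * E1 p / (1 - E1 p))"
        unfolding f_def real_norm_def by (rule abs_Im_le_cmod)
      also have "\<dots> = exp p * exp (- (x * a * exp (\<nu> * p))) / norm (1 - E1 p)"
        by (simp add: norm_mult norm_divide)
      also have "\<dots> \<le> exp p * exp (- (x * a * exp (\<nu> * p))) / (1 + a * exp p)"
      proof (rule divide_left_mono)
        show le: "1 + a * exp p \<le> norm (1 - E1 p)" using one_minus_E1_ge[of 1 p] by simp
        have "0 < 1 + a * exp p" using a_pos by (simp add: add_pos_pos)
        then show "0 < norm (1 - E1 p) * (1 + a * exp p)" using le by (intro mult_pos_pos) auto
      qed simp
      finally show "norm (f p) \<le> norm (exp p * exp (- (x * a * exp (\<nu> * p))) / (1 + a * exp p))"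
        unfolding real_norm_def by (rule order.trans[OF _ abs_ge_self])
    qed
  qed simp
  have "(LBINT p=-\<infinity>..\<infinity>. f p) = (c + exp (- x) * (pi / 2)) - (c + exp (- x) * (- (pi / 2)))"
  proof (rule interval_integral_FTC_integrable)
    show "(T has_vector_derivative f p) (at p)" for p
      using dT by (simp add: has_real_derivative_iff_has_vector_derivative)
    have "continuous_on UNIV f" unfolding f_def using E1_nz by (intro continuous_intros) auto
    then show "isCont f p" for p by (simp add: continuous_on_eq_continuous_at)
    show "set_integrable lborel (einterval (-\<infinity>) \<infinity>) f"
      using intf by (simp add: set_integrable_def einterval_eq_UNIV)
  qed (use T_top T_bot in \<open>simp_all add: ereal_tendsto_simps\<close>)
  then have "(\<integral>p. f p \<partial>lborel) = pi * exp (- x)"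
    by (simp add: interval_lebesgue_integral_def set_lebesgue_integral_def einterval_eq_UNIV)
  then show "integrable lborel (\<lambda>p. Im (exp (- x * E2 p) * E1 p / (1 - E1 p)))"
    and "(\<integral>p. Im (exp (- x * E2 p) * E1 p / (1 - E1 p)) \<partial>lborel) = pi * exp (- x)"
    using intf by (simp_all add: f_def[abs_def])
qed

end

lemma einterval_0_infinity: "einterval 0 \<infinity> = {0<..}"
  by (auto simp: einterval_def)

lemma laplace_exp_real:
  fixes c :: real assumes "c > 0"
  shows "set_integrable lborel {0<..} (\<lambda>s. exp (- c * s))" "(LBINT s:{0<..}. exp (- c * s)) = 1 / c"
proof -
  define F where "F s = - exp (- c * s) / c" for s
  have d: "(F has_real_derivative exp (- c * s)) (at s)" for s
    using assms unfolding F_def by (auto intro!: derivative_eq_intros)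
  have l: "((F \<circ> real_of_ereal) \<longlongrightarrow> - 1 / c) (at_right 0)"
    unfolding ereal_tendsto_simps zero_ereal_def F_def
    using assms by real_asymp (simp add: divide_inverse)
  have r: "((F \<circ> real_of_ereal) \<longlongrightarrow> 0) (at_left \<infinity>)"
    unfolding ereal_tendsto_simps F_def using assms by real_asymp
  have c: "isCont (\<lambda>s. exp (- c * s)) s" for s by (intro continuous_intros)
  note FTC = interval_integral_FTC_nonneg[of 0 \<infinity>, OF _ d c _ l r]
  have "set_integrable lborel (einterval 0 \<infinity>) (\<lambda>s. exp (- c * s))" "(LBINT s=0..\<infinity>. exp (- c * s)) = 0 - (- 1 / c)"
    by (rule FTC; simp)+
  then show "set_integrable lborel {0<..} (\<lambda>s. exp (- c * s))" "(LBINT s:{0<..}. exp (- c * s)) = 1 / c"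
    by (auto simp: einterval_0_infinity interval_lebesgue_integral_def)
qed

lemma laplace_exp_complex:
  fixes z :: complex assumes "Re z > 0"
  shows "set_integrable lborel {0<..} (\<lambda>s. exp (- z * of_real s))"
    and "(LBINT s:{0<..}. exp (- z * of_real s)) = 1 / z"
proof -
  have z: "z \<noteq> 0" using assms by auto
  show int: "set_integrable lborel {0<..} (\<lambda>s. exp (- z * of_real s))"
    unfolding set_integrable_def
  proof (rule Bochner_Integration.integrable_bound)
    show "integrable lborel (\<lambda>s. indicat_real {0<..} s *\<^sub>R exp (- Re z * s))"
      using laplace_exp_real(1)[OF assms] by (simp add: set_integrable_def)
  qed (auto simp: indicator_def)
  have "(LBINT s=0..\<infinity>. exp (- z * of_real s)) = 0 - (- 1 / z)"
  proof (rule interval_integral_FTC_integrable)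
    show "((\<lambda>s. - exp (- z * of_real s) / z) has_vector_derivative exp (- z * of_real s)) (at s)" for s
    proof -
      have "((\<lambda>s. - exp (- z * s) / z) has_field_derivative exp (- z * of_real s)) (at (of_real s))"
        using z by (auto intro!: derivative_eq_intros)
      then show ?thesis by (rule has_vector_derivative_real_field)
    qed
    have "((\<lambda>s. - exp (- z * of_real s) / z) \<longlongrightarrow> - exp (- z * of_real 0) / z) (at_right 0)"
      using z by (intro tendsto_intros) auto
    then show "(((\<lambda>s. - exp (- z * of_real s) / z) \<circ> real_of_ereal) \<longlongrightarrow> - 1 / z) (at_right 0)"
      unfolding ereal_tendsto_simps zero_ereal_def by simp
    have "((\<lambda>s. exp (- Re z * s) / norm z) \<longlongrightarrow> 0) at_top"
      using assms z by real_asymp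
    then have "((\<lambda>s. - exp (- z * of_real s) / z) \<longlongrightarrow> 0) at_top"
      by (rule Lim_null_comparison[rotated]) (simp add: norm_divide)
    then show "(((\<lambda>s. - exp (- z * of_real s) / z) \<circ> real_of_ereal) \<longlongrightarrow> 0) (at_left \<infinity>)"
      unfolding ereal_tendsto_simps .
  qed (use int in \<open>auto intro!: continuous_intros simp: einterval_0_infinity\<close>)
  then show "(LBINT s:{0<..}. exp (- z * of_real s)) = 1 / z"
    by (simp add: einterval_0_infinity interval_lebesgue_integral_def)
qed

lemma integrable_double_exp:
  fixes c :: real assumes "c > 0"
  shows "integrable lborel (\<lambda>p. exp p * exp (- c * exp p))"
proof -
  have "set_integrable lborel (einterval (-\<infinity>) \<infinity>) (\<lambda>p. exp p * exp (- c * exp p))"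
  proof (rule interval_integral_FTC_nonneg)
    show "((\<lambda>p. - exp (- c * exp p) / c) has_real_derivative exp p * exp (- c * exp p)) (at p)" for p
      using assms by (auto intro!: derivative_eq_intros)
    show "(((\<lambda>p. - exp (- c * exp p) / c) \<circ> real_of_ereal) \<longlongrightarrow> - 1 / c) (at_right (- \<infinity>))"
      unfolding ereal_tendsto_simps using assms by real_asymp (simp add: divide_inverse)
    show "(((\<lambda>p. - exp (- c * exp p) / c) \<circ> real_of_ereal) \<longlongrightarrow> 0) (at_left \<infinity>)"
      unfolding ereal_tendsto_simps using assms by real_asymp
  qed (use assms in \<open>auto intro!: continuous_intros\<close>)
  then show ?thesis by (simp add: set_integrable_def einterval_eq_UNIV)
qed

context stable_index
begin

text \<open>The density of the \<open>\<nu>\<close>-stable subordinator is \<open>P (x s\<^sup>-\<^sup>\<nu>) / s\<close> with \<open>P = Pd 0\<close>, and \<open>Pd k\<close> is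
  the \<open>k\<close>-th derivative of \<open>P\<close>.\<close>

definition ker :: "nat \<Rightarrow> real \<Rightarrow> real \<Rightarrow> real" where
  "ker k w p = Im ((- E2 p) ^ k * exp (E1 p - w * E2 p) * E1 p)"

definition Pd :: "nat \<Rightarrow> real \<Rightarrow> real" where
  "Pd k w = (\<integral>p. ker k w p \<partial>lborel) / pi"

lemma ker_measurable [measurable]: "ker k w \<in> borel_measurable borel"
  unfolding ker_def[abs_def] by measurable

definition kb :: "real \<Rightarrow> real" where
  "kb p = (1 + 8 / a\<^sup>2) * (exp p * exp (- (a / 2) * exp p))"

lemma integrable_kb: "integrable lborel kb"
  unfolding kb_def[abs_def] using a_pos by (intro integrable_mult_right integrable_double_exp) auto

lemma ker_bound:
  assumes "w \<ge> 0" "k \<le> 2"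
  shows "\<bar>ker k w p\<bar> \<le> kb p"
proof -
  let ?y = "exp p"
  have "\<bar>ker k w p\<bar> \<le> norm ((- E2 p) ^ k * exp (E1 p - w * E2 p) * E1 p)"
    unfolding ker_def by (rule abs_Im_le_cmod)
  also have "\<dots> = exp (\<nu> * p) ^ k * exp (- (a * ?y) - w * (a * exp (\<nu> * p))) * ?y"
    by (simp add: norm_mult norm_power)
  also have "\<dots> \<le> (1 + ?y\<^sup>2) * exp (- (a * ?y)) * ?y"
  proof (intro mult_right_mono mult_mono)
    show "exp (- (a * ?y) - w * (a * exp (\<nu> * p))) \<le> exp (- (a * ?y))"
      using assms a_pos by simp
    have "exp (\<nu> * p) ^ k = exp ((k * \<nu>) * p)" by (simp add: exp_of_nat_mult[symmetric] mult.assoc)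
    also have "\<dots> \<le> 1 + ?y\<^sup>2"
    proof (cases "p \<ge> 0")
      case True
      have "real k * \<nu> \<le> 2 * 1" using assms nu_pos nu_less_1 by (intro mult_mono) auto
      then have "exp ((k * \<nu>) * p) \<le> exp (2 * p)" using True by (simp add: mult_right_mono)
      also have "\<dots> = ?y\<^sup>2" by (simp add: exp_double)
      finally show ?thesis by simp
    next
      case False
      then have "exp ((k * \<nu>) * p) \<le> 1" using nu_pos by (simp add: mult_le_0_iff)
      then show ?thesis by (simp add: add_increasing2)
    qed
    finally show "exp (\<nu> * p) ^ k \<le> 1 + ?y\<^sup>2" .
  qed auto
  also have "\<dots> \<le> kb p"
  proof -
    define u where "u = a / 2 * ?y"
    have u: "u \<ge> 0" using a_pos by (simp add: u_def)
    have "1 + u + u\<^sup>2 / 2 \<le> exp u" using exp_lower_Taylor_quadratic[OF u] by simp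
    then have "8 / a\<^sup>2 * (u\<^sup>2 / 2) \<le> 8 / a\<^sup>2 * exp u" using u by (intro mult_left_mono) auto
    moreover have "8 / a\<^sup>2 * (u\<^sup>2 / 2) = ?y\<^sup>2" using a_pos by (simp add: u_def field_simps power2_eq_square)
    ultimately have "1 + ?y\<^sup>2 \<le> (1 + 8 / a\<^sup>2) * exp u" using u by (simp add: ring_distribs add_mono)
    then have "(1 + ?y\<^sup>2) * exp (- u) * exp (- u) * ?y \<le> (1 + 8 / a\<^sup>2) * exp u * exp (- u) * exp (- u) * ?y"
      by (intro mult_right_mono) auto
    moreover have "exp (- (a * ?y)) = exp (- u) * exp (- u)" by (simp add: u_def exp_add[symmetric])
    moreover have "(1 + 8 / a\<^sup>2) * exp u * exp (- u) * exp (- u) * ?y = kb p"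
    proof -
      have "exp u * exp (- u) = 1" by (simp add: exp_minus)
      moreover have "exp (- (a / 2) * ?y) = exp (- u)" by (simp add: u_def)
      ultimately show ?thesis unfolding kb_def by (simp add: mult.assoc mult.left_commute)
    qed
    ultimately show ?thesis by (simp only: mult.assoc)
  qed
  finally show ?thesis .
qed

lemma integrable_ker: "w \<ge> 0 \<Longrightarrow> k \<le> 2 \<Longrightarrow> integrable lborel (ker k w)"
  by (rule Bochner_Integration.integrable_bound[OF integrable_kb])
    (auto intro!: AE_I2 order.trans[OF ker_bound abs_ge_self])

lemma Pd_deriv:
  assumes "w > 0" "k \<le> 1"
  shows "(Pd k has_real_derivative Pd (Suc k) w) (at w)"
proof -
  have "((\<lambda>w. \<integral>p. ker k w p \<partial>lborel) has_real_derivative (\<integral>p. ker (Suc k) w p \<partial>lborel)) (at w)"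
  proof (rule has_real_derivative_integral(2))
    show "w \<in> {0<..<w + 1}" using assms by simp
    show "integrable lborel (ker k v)" if "v \<in> {0<..<w + 1}" for v
      using that assms by (intro integrable_ker) auto
    show "((\<lambda>v. ker k v p) has_real_derivative ker (Suc k) v p) (at v)" for v p
    proof -
      have "((\<lambda>v. (- E2 p) ^ k * exp (E1 p - of_real v * E2 p) * E1 p) has_vector_derivative
          ((- E2 p) ^ Suc k * exp (E1 p - of_real v * E2 p) * E1 p)) (at v)"
        by (rule has_vector_derivative_real_field) (auto intro!: derivative_eq_intros)
      from bounded_linear.has_vector_derivative[OF bounded_linear_Im this]
      show ?thesis by (simp only: ker_def has_real_derivative_iff_has_vector_derivative)
    qed
    show "\<bar>ker (Suc k) v p\<bar> \<le> kb p" if "v \<in> {0<..<w + 1}" for v p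
      using that assms by (intro ker_bound) auto
  qed (rule integrable_kb)
  then show ?thesis unfolding Pd_def[abs_def] by (rule DERIV_cdivide)
qed

lemma Pd_bounded: "\<exists>C. \<forall>w\<ge>0. \<forall>k\<le>2. \<bar>Pd k w\<bar> \<le> C"
proof (intro exI allI impI)
  fix w :: real and k :: nat assume w: "w \<ge> 0" "k \<le> 2"
  have "\<bar>\<integral>p. ker k w p \<partial>lborel\<bar> \<le> (\<integral>p. \<bar>ker k w p\<bar> \<partial>lborel)"
    using integral_norm_bound[of lborel "ker k w"] by simp
  also have "\<dots> \<le> (\<integral>p. kb p \<partial>lborel)"
    using integrable_ker[OF w] integrable_kb ker_bound[OF w] by (intro integral_mono) auto
  finally show "\<bar>Pd k w\<bar> \<le> (\<integral>p. kb p \<partial>lborel) / pi"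
    by (simp add: Pd_def divide_right_mono)
qed

lemma Pd_0_0: "Pd 0 0 = 0"
proof -
  have "(LBINT p=-\<infinity>..\<infinity>. ker 0 0 p) = 0 - 0"
  proof (rule interval_integral_FTC_integrable)
    define F where "F p = exp (- a * exp p) * sin (exp p * sin \<theta>)" for p
    show "(F has_vector_derivative ker 0 0 p) (at p)" for p
      unfolding F_def has_real_derivative_iff_has_vector_derivative[symmetric]
      by (auto intro!: derivative_eq_intros simp: ker_def Re_exp Im_exp algebra_simps)
    have "continuous_on UNIV (ker 0 0)"
      unfolding ker_def[abs_def] by (intro continuous_intros)
    then show "isCont (ker 0 0) p" for p by (simp add: continuous_on_eq_continuous_at)
    show "set_integrable lborel (einterval (-\<infinity>) \<infinity>) (ker 0 0)"
      using integrable_ker[of 0 0] by (simp add: set_integrable_def einterval_eq_UNIV)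
    have "((\<lambda>p. exp (- a * exp p)) \<longlongrightarrow> 0) at_top" using a_pos by real_asymp
    then have "(F \<longlongrightarrow> 0) at_top"
      by (rule Lim_null_comparison[rotated]) (simp add: F_def abs_mult mult_left_le)
    then show "((F \<circ> real_of_ereal) \<longlongrightarrow> 0) (at_left \<infinity>)" by (simp add: ereal_tendsto_simps)
    have e: "((\<lambda>p::real. exp p) \<longlongrightarrow> 0) at_bot" by real_asymp
    have "(F \<longlongrightarrow> exp (- a * 0) * sin (0 * sin \<theta>)) at_bot"
      unfolding F_def by (intro tendsto_intros e)
    then show "((F \<circ> real_of_ereal) \<longlongrightarrow> 0) (at_right (-\<infinity>))" by (simp add: ereal_tendsto_simps)
  qed simp
  then show ?thesis by (simp add: Pd_def interval_lebesgue_integral_def set_lebesgue_integral_def einterval_eq_UNIV)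
qed

lemma Pd_0_tendsto: "(Pd 0 \<longlongrightarrow> 0) (at_right 0)"
proof (subst tendsto_at_iff_sequentially, safe)
  fix X :: "nat \<Rightarrow> real" assume X: "\<forall>i. X i \<in> {0<..} - {0}" "X \<longlonglongrightarrow> 0"
  have "(\<lambda>n. \<integral>p. ker 0 (X n) p \<partial>lborel) \<longlonglongrightarrow> (\<integral>p. ker 0 0 p \<partial>lborel)"
  proof (rule integral_dominated_convergence[where w = kb])
    show "AE p in lborel. (\<lambda>n. ker 0 (X n) p) \<longlonglongrightarrow> ker 0 0 p"
    proof (rule AE_I2)
      fix p
      have "(\<lambda>n. ker 0 (X n) p) \<longlonglongrightarrow> Im ((- E2 p) ^ 0 * exp (E1 p - of_real 0 * E2 p) * E1 p)"
        unfolding ker_def by (intro tendsto_intros X)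
      then show "(\<lambda>n. ker 0 (X n) p) \<longlonglongrightarrow> ker 0 0 p" by (simp add: ker_def)
    qed
    show "AE p in lborel. norm (ker 0 (X n) p) \<le> kb p" for n
      using X(1) by (auto intro!: AE_I2 ker_bound simp: less_imp_le)
  qed (auto intro: integrable_kb)
  then have "(\<lambda>n. Pd 0 (X n)) \<longlonglongrightarrow> Pd 0 0" unfolding Pd_def by (intro tendsto_intros) auto
  then show "(Pd 0 \<circ> X) \<longlonglongrightarrow> 0" by (simp add: Pd_0_0 o_def)
qed

lemma Pd_continuous_on: "k \<le> 1 \<Longrightarrow> continuous_on {0<..} (Pd k)"
  using Pd_deriv by (meson DERIV_continuous_on has_field_derivative_at_within greaterThan_iff)

lemma Pd_scaled:
  assumes "s > 0"
  shows "Pd 0 (x * s powr (- \<nu>)) / s = (\<integral>p. Im (exp (s * E1 p - x * E2 p) * E1 p) \<partial>lborel) / pi"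
proof -
  have e: "exp (\<nu> * ln s) = s powr \<nu>" using assms by (simp add: powr_def)
  have "(\<integral>p. ker 0 (x * s powr (- \<nu>)) p \<partial>lborel) = (\<integral>p. ker 0 (x * s powr (- \<nu>)) (ln s + 1 * p) \<partial>lborel)"
    by (subst lborel_integral_real_affine[of 1 _ "ln s"]) simp_all
  also have "\<dots> = (\<integral>p. s * Im (exp (s * E1 p - x * E2 p) * E1 p) \<partial>lborel)"
  proof (intro Bochner_Integration.integral_cong refl)
    fix p
    have "of_real (x * s powr - \<nu>) * E2 (p + ln s) = of_real x * (of_real (s powr - \<nu> * s powr \<nu>) * E2 p)"
      unfolding E_add e by (simp add: exp_of_real[symmetric] mult_ac)
    also have "s powr - \<nu> * s powr \<nu> = 1" using assms by (simp add: powr_minus)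
    finally have "of_real (x * s powr - \<nu>) * E2 (ln s + p) = of_real x * E2 p" by (simp add: add.commute)
    moreover have "E1 (ln s + p) = of_real s * E1 p"
      using E_add(1)[of p "ln s"] assms by (simp add: add.commute exp_of_real)
    ultimately have "ker 0 (x * s powr (- \<nu>)) (ln s + 1 * p) = Im (exp (s * E1 p - x * E2 p) * (of_real s * E1 p))"
      by (simp only: ker_def power_0 mult_1_left)
    also have "\<dots> = s * Im (exp (s * E1 p - x * E2 p) * E1 p)" by (simp add: algebra_simps)
    finally show "ker 0 (x * s powr (- \<nu>)) (ln s + 1 * p) = s * Im (exp (s * E1 p - x * E2 p) * E1 p)" .
  qed
  finally show ?thesis using assms by (simp add: Pd_def)
qed

lemma laplace_Pd:
  fixes x l :: real
  assumes x: "x > 0" and l: "l > 0"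
  shows "set_integrable lborel {0<..} (\<lambda>s. exp (- l * s) * (Pd 0 (x * s powr (- \<nu>)) / s))"
    and "(LBINT s:{0<..}. exp (- l * s) * (Pd 0 (x * s powr (- \<nu>)) / s)) = exp (- x * l powr \<nu>)"
proof -
  define H where "H p s = indicat_real {0<..} s * (exp (- (l + a * exp p) * s) * (exp p * exp (- (x * a * exp (\<nu> * p)))))" for p s
  define F where "F p s = indicat_real {0<..} s * Im (exp (- l * s) * (exp (s * E1 p - x * E2 p) * E1 p))" for p s
  have Hm: "(\<lambda>(p, s). H p s) \<in> borel_measurable (lborel \<Otimes>\<^sub>M lborel)" unfolding H_def by measurable
  have Fm: "(\<lambda>(p, s). F p s) \<in> borel_measurable (lborel \<Otimes>\<^sub>M lborel)" unfolding F_def by measurable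
  have Hnn: "H p s \<ge> 0" for p s by (simp add: H_def)
  have FH: "norm (F p s) \<le> H p s" for p s
  proof -
    have "\<bar>Im (exp (- l * s) * (exp (s * E1 p - x * E2 p) * E1 p))\<bar> \<le> norm (exp (- l * s) * (exp (s * E1 p - x * E2 p) * E1 p))"
      by (rule abs_Im_le_cmod)
    also have "\<dots> = exp (- (l + a * exp p) * s) * (exp p * exp (- (x * a * exp (\<nu> * p))))"
      by (simp add: norm_mult exp_add[symmetric] algebra_simps)
    finally show ?thesis by (simp add: F_def H_def abs_mult indicator_def)
  qed
  have Hint: "integrable lborel (H p)" "(\<integral>s. H p s \<partial>lborel) = exp p * exp (- (x * a * exp (\<nu> * p))) / (l + a * exp p)" for p
  proof -
    have c: "l + a * exp p > 0" using a_pos l by (simp add: add_pos_pos)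
    note L = laplace_exp_real[OF c, unfolded set_integrable_def set_lebesgue_integral_def]
    have H: "H p = (\<lambda>s. (exp p * exp (- (x * a * exp (\<nu> * p)))) * (indicat_real {0<..} s *\<^sub>R exp (- (l + a * exp p) * s)))"
      by (auto simp: H_def fun_eq_iff)
    show "integrable lborel (H p)" unfolding H by (rule integrable_mult_right) (rule L)
    show "(\<integral>s. H p s \<partial>lborel) = exp p * exp (- (x * a * exp (\<nu> * p))) / (l + a * exp p)"
      unfolding H integral_mult_right_zero L(2) by simp
  qed
  have "integrable (lborel \<Otimes>\<^sub>M lborel) (\<lambda>(p, s). H p s)"
  proof (rule lborel_pair.Fubini_integrable[OF Hm])
    show "integrable lborel (\<lambda>p. \<integral>s. norm (case (p, s) of (p, s) \<Rightarrow> H p s) \<partial>lborel)"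
      using integrable_kernel[OF x l] Hnn by (simp add: Hint)
  qed (simp add: Hint)
  then have Fint: "integrable (lborel \<Otimes>\<^sub>M lborel) (\<lambda>(p, s). F p s)"
    by (rule Bochner_Integration.integrable_bound[OF _ Fm]) (use FH Hnn in auto)
  have Fs: "(\<integral>s. F p s \<partial>lborel) = Im (exp (- x * E2 p) * E1 p / (of_real l - E1 p))" for p
  proof -
    have r: "Re (of_real l - E1 p) > 0" using a_pos l by (simp add: add_pos_pos)
    note L = laplace_exp_complex[OF r, unfolded set_integrable_def set_lebesgue_integral_def]
    have "(\<integral>s. F p s \<partial>lborel) = (\<integral>s. Im ((exp (- x * E2 p) * E1 p) * (indicat_real {0<..} s *\<^sub>R exp (- (of_real l - E1 p) * of_real s))) \<partial>lborel)"
    proof (intro Bochner_Integration.integral_cong refl)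
      fix s
      have "of_real (exp (- l * s)) * (exp (s * E1 p - x * E2 p) * E1 p) = (exp (- x * E2 p) * E1 p) * exp (- (of_real l - E1 p) * of_real s)"
        by (simp add: exp_of_real[symmetric] exp_add[symmetric] exp_diff exp_minus field_simps)
      moreover have "F p s = Im (indicat_real {0<..} s *\<^sub>R (of_real (exp (- l * s)) * (exp (s * E1 p - x * E2 p) * E1 p)))"
        by (simp only: F_def scaleR_complex.sel)
      ultimately show "F p s = Im ((exp (- x * E2 p) * E1 p) * (indicat_real {0<..} s *\<^sub>R exp (- (of_real l - E1 p) * of_real s)))"
        by (simp only: mult_scaleR_right)
    qed
    also have "\<dots> = Im (\<integral>s. (exp (- x * E2 p) * E1 p) * (indicat_real {0<..} s *\<^sub>R exp (- (of_real l - E1 p) * of_real s)) \<partial>lborel)"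
      by (rule integral_Im) (intro integrable_mult_right L(1))
    also have "\<dots> = Im (exp (- x * E2 p) * E1 p / (of_real l - E1 p))"
      unfolding integral_mult_right_zero L(2) by simp
    finally show ?thesis .
  qed
  have Fp: "(\<integral>p. F p s \<partial>lborel) = pi * (indicat_real {0<..} s *\<^sub>R (exp (- l * s) * (Pd 0 (x * s powr (- \<nu>)) / s)))" for s
  proof (cases "s > 0")
    case True
    have "(\<integral>p. F p s \<partial>lborel) = (\<integral>p. exp (- l * s) * Im (exp (s * E1 p - x * E2 p) * E1 p) \<partial>lborel)"
      using True by (intro Bochner_Integration.integral_cong refl) (simp add: F_def)
    then show ?thesis using True by (simp add: Pd_scaled)
  qed (simp add: F_def)
  have "integrable lborel (\<lambda>s. (1 / pi) * (\<integral>p. F p s \<partial>lborel))"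
    by (intro integrable_mult_right lborel_pair.integrable_snd[OF Fint])
  then show "set_integrable lborel {0<..} (\<lambda>s. exp (- l * s) * (Pd 0 (x * s powr (- \<nu>)) / s))"
    unfolding Fp set_integrable_def by simp
  have "pi * (LBINT s:{0<..}. exp (- l * s) * (Pd 0 (x * s powr (- \<nu>)) / s)) = (\<integral>s. \<integral>p. F p s \<partial>lborel \<partial>lborel)"
    unfolding Fp set_lebesgue_integral_def by (rule integral_mult_right_zero[symmetric])
  also have "\<dots> = (\<integral>p. \<integral>s. F p s \<partial>lborel \<partial>lborel)" by (rule lborel_pair.Fubini_integral[OF Fint])
  also have "\<dots> = (\<integral>p. Im (exp (- x * E2 p) * E1 p / (of_real l - E1 p)) \<partial>lborel)" by (simp add: Fs)
  also have "\<dots> = (\<integral>p. Im (exp (- x * E2 (ln l + 1 * p)) * E1 (ln l + 1 * p) / (of_real l - E1 (ln l + 1 * p))) \<partial>lborel)"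
    by (subst lborel_integral_real_affine[of 1 _ "ln l"]) simp_all
  also have "\<dots> = (\<integral>p. Im (exp (- (x * l powr \<nu>) * E2 p) * E1 p / (1 - E1 p)) \<partial>lborel)"
  proof (intro Bochner_Integration.integral_cong refl)
    fix p
    have "E1 (ln l + 1 * p) = of_real l * E1 p" "E2 (ln l + 1 * p) = of_real (l powr \<nu>) * E2 p"
      using E_add[of p "ln l"] l by (simp_all add: add.commute powr_def exp_of_real)
    moreover have "of_real l - of_real l * E1 p = of_real l * (1 - E1 p)" by (simp add: algebra_simps)
    ultimately show "Im (exp (- x * E2 (ln l + 1 * p)) * E1 (ln l + 1 * p) / (of_real l - E1 (ln l + 1 * p)))
        = Im (exp (- (x * l powr \<nu>) * E2 p) * E1 p / (1 - E1 p))"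
      using l E1_nz[of p] by (simp add: mult_ac)
  qed
  also have "\<dots> = pi * exp (- (x * l powr \<nu>))"
    using cauchy_kernel_integral(2)[of "x * l powr \<nu>"] x l by simp
  finally show "(LBINT s:{0<..}. exp (- l * s) * (Pd 0 (x * s powr (- \<nu>)) / s)) = exp (- x * l powr \<nu>)"
    by simp
qed

end

section \<open>Moments and the Abel integral equation\<close>

lemma nn_integral_Gamma:
  fixes c :: real assumes "c > 0"
  shows "(\<integral>\<^sup>+t. ennreal (indicator {0<..} t * (t powr (c - 1) * exp (- t))) \<partial>lborel) = ennreal (Gamma c)"
  using Gamma_conv_nn_integral_real[OF assms]
  by (auto intro!: nn_integral_cong simp: indicator_def exp_minus field_simps)

lemma Gamma_ge_powr_exp:
  fixes R s :: real assumes "R > 0" "s \<ge> 1"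
  shows "Gamma s \<ge> R powr (s - 1) * exp (- R)"
proof -
  have "(\<integral>\<^sup>+t. ennreal (indicator {0<..} t * exp (- t)) \<partial>lborel) = (\<integral>\<^sup>+t. ennreal (indicator {0<..} t * (t powr (1 - 1) * exp (- t))) \<partial>lborel)"
    by (intro nn_integral_cong) (auto simp: indicator_def)
  also have "\<dots> = 1" using nn_integral_Gamma[of 1] by simp
  finally have "ennreal (R powr (s - 1) * exp (- R)) = (\<integral>\<^sup>+t. ennreal (R powr (s - 1) * exp (- R)) * ennreal (indicator {0<..} t * exp (- t)) \<partial>lborel)"
    by (subst nn_integral_cmult) auto
  also have "\<dots> \<le> (\<integral>\<^sup>+t. ennreal (indicator {0..} (R + t) * (R + t) powr (s - 1) / exp (R + t)) \<partial>lborel)"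
  proof (rule nn_integral_mono)
    fix t :: real
    show "ennreal (R powr (s - 1) * exp (- R)) * ennreal (indicator {0<..} t * exp (- t))
        \<le> ennreal (indicator {0..} (R + t) * (R + t) powr (s - 1) / exp (R + t))"
    proof (cases "t > 0")
      case True
      have "R powr (s - 1) * (exp (- R) * exp (- t)) \<le> (R + t) powr (s - 1) * (exp (- R) * exp (- t))"
        using True assms by (intro mult_right_mono powr_mono2) auto
      then show ?thesis using True assms
        by (simp add: ennreal_mult[symmetric] exp_add exp_minus divide_inverse mult_ac)
    qed simp
  qed
  also have "\<dots> = (\<integral>\<^sup>+t. ennreal (indicator {0..} t * t powr (s - 1) / exp t) \<partial>lborel)"
    by (subst nn_integral_real_affine[of _ 1 R]) auto
  also have "\<dots> = ennreal (Gamma s)" using assms by (subst Gamma_conv_nn_integral_real) auto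
  finally show ?thesis using assms by simp
qed

lemma summable_power_div_Gamma:
  fixes p c :: real assumes p: "p \<ge> 0" and c: "c > 0"
  shows "summable (\<lambda>n. p ^ n / Gamma (c * (real n + 1)))"
proof -
  define R where "R = (2 * p + 1) powr (1 / c)"
  have R: "R > 0" using p by (simp add: R_def)
  have Rc: "R powr c = 2 * p + 1" using p c by (simp add: R_def powr_powr)
  show ?thesis
  proof (rule summable_comparison_test_ev)
    show "summable (\<lambda>n. (R powr (1 - c) * exp R) * (1 / 2) ^ n)"
      by (intro summable_mult summable_geometric) simp
    show "eventually (\<lambda>n. norm (p ^ n / Gamma (c * (real n + 1))) \<le> (R powr (1 - c) * exp R) * (1 / 2) ^ n) sequentially"
    proof (rule eventually_mono[OF eventually_ge_at_top[of "nat \<lceil>1 / c\<rceil>"]])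
      fix n assume "n \<ge> nat \<lceil>1 / c\<rceil>"
      then have "1 / c \<le> real n" by linarith
      then have s: "c * (real n + 1) \<ge> 1" using c by (simp add: field_simps)
      have "R powr (c * (real n + 1) - 1) * exp (- R) \<le> Gamma (c * (real n + 1))"
        using Gamma_ge_powr_exp[OF R s] .
      moreover have "R powr (c * (real n + 1) - 1) = (R powr c) ^ n * R powr (c - 1)"
        using R by (simp add: powr_power powr_add[symmetric] algebra_simps)
      ultimately have g: "(2 * p + 1) ^ n * R powr (c - 1) * exp (- R) \<le> Gamma (c * (real n + 1))"
        by (simp add: Rc)
      have pos: "(2 * p + 1) ^ n * R powr (c - 1) * exp (- R) > 0" using p R by simp
      have "norm (p ^ n / Gamma (c * (real n + 1))) = p ^ n / Gamma (c * (real n + 1))"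
        using p g pos by simp
      also have "\<dots> \<le> p ^ n / ((2 * p + 1) ^ n * R powr (c - 1) * exp (- R))"
        using p g pos by (intro divide_left_mono mult_pos_pos) auto
      also have "\<dots> = (R powr (1 - c) * exp R) * (p / (2 * p + 1)) ^ n"
        using R p by (simp add: power_divide exp_minus powr_diff field_simps)
      also have "\<dots> \<le> (R powr (1 - c) * exp R) * (1 / 2) ^ n"
        using p by (intro mult_left_mono power_mono) (auto simp: field_simps)
      finally show "norm (p ^ n / Gamma (c * (real n + 1))) \<le> (R powr (1 - c) * exp R) * (1 / 2) ^ n" .
    qed
  qed
qed

lemma nn_integral_Beta:
  fixes t b c :: real assumes t: "t > 0" and b: "b > 0" and c: "c > 0"
  shows "(\<integral>\<^sup>+r. ennreal (indicator {0<..<t} r * ((t - r) powr (c - 1) * r powr (b - 1))) \<partial>lborel) = ennreal (t powr (b + c - 1) * Beta b c)"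
proof -
  have "(\<integral>\<^sup>+r. ennreal (indicator {0<..<t} r * ((t - r) powr (c - 1) * r powr (b - 1))) \<partial>lborel)
      = t * (\<integral>\<^sup>+r. ennreal (indicator {0<..<t} (t * r) * ((t - t * r) powr (c - 1) * (t * r) powr (b - 1))) \<partial>lborel)"
    using t by (subst nn_integral_real_affine[of _ t 0]) auto
  also have "(\<integral>\<^sup>+r. ennreal (indicator {0<..<t} (t * r) * ((t - t * r) powr (c - 1) * (t * r) powr (b - 1))) \<partial>lborel)
      = (\<integral>\<^sup>+r. ennreal (t powr (b + c - 2)) * ennreal (indicator {0..1} r * (r powr (b - 1) * (1 - r) powr (c - 1))) \<partial>lborel)"
  proof (intro nn_integral_cong)
    fix r :: real
    have e1: "t - t * r = t * (1 - r)" by (simp add: algebra_simps)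
    have e2: "t * r < t \<longleftrightarrow> r < 1" using t by simp
    have e3: "t powr (c - 1) * t powr (b - 1) = t powr (b + c - 2)"
      using t by (simp add: powr_add[symmetric] algebra_simps)
    show "ennreal (indicator {0<..<t} (t * r) * ((t - t * r) powr (c - 1) * (t * r) powr (b - 1)))
      = ennreal (t powr (b + c - 2)) * ennreal (indicator {0..1} r * (r powr (b - 1) * (1 - r) powr (c - 1)))"
    proof (cases "0 < r \<and> r < 1")
      case True
      then show ?thesis using t e1 e2 e3 
        by (simp add: powr_mult ennreal_mult[symmetric] mult_ac)
    next
      case False
      then have "r \<le> 0 \<or> 1 \<le> r" by linarith
      then have "indicator {0..1} r * (r powr (b - 1) * (1 - r) powr (c - 1)) = 0"
        by (cases "r = 0 \<or> r = 1") (auto simp: indicator_def)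
      moreover have "indicator {0<..<t} (t * r) = (0::real)"
        using \<open>r \<le> 0 \<or> 1 \<le> r\<close> t by (auto simp: indicator_def zero_less_mult_iff)
      ultimately show ?thesis by simp
    qed
  qed
  also have "\<dots> = ennreal (t powr (b + c - 2)) * ennreal (Beta b c)"
    using nn_integral_has_integral_lebesgue[OF _ has_integral_Beta_real[OF b c]]
    by (subst nn_integral_cmult) auto
  finally show ?thesis
    using t b c by (simp add: ennreal_mult[symmetric] Beta_def powr_diff powr_add field_simps power2_eq_square)
qed

text \<open>Positivity of \<open>P\<close> is not visible from the integral defining it; it is inherited from the given density.\<close>

locale stable_positive = stable_index +
  assumes Pd_nonneg: "\<And>w. w > 0 \<Longrightarrow> Pd 0 w \<ge> 0"
begin

definition Q :: "real \<Rightarrow> real" where "Q z = indicator {0<..} z * Pd 0 z"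

lemma Q_nonneg: "Q z \<ge> 0"
  using Pd_nonneg by (auto simp: Q_def indicator_def)

lemma Q_measurable [measurable]: "Q \<in> borel_measurable borel"
  unfolding Q_def[abs_def] using borel_measurable_continuous_on_indicator[OF _ Pd_continuous_on[of 0]] by simp

lemma Q_moment:
  "has_bochner_integral lborel (\<lambda>z. z ^ n * Q z) (fact n / Gamma (\<nu> * (real n + 1)))"
proof (rule has_bochner_integral_nn_integral)
  define c where "c = (\<integral>\<^sup>+z. ennreal (z ^ n * Q z) \<partial>lborel)"
  define H where "H x s = indicator {0<..} s * (exp (- s) / s) * (x ^ n * Q (x * s powr (- \<nu>)))" for x s :: real
  have zQ: "z ^ n * Q z \<ge> 0" for z :: real by (cases "z > 0") (auto simp: Q_nonneg, simp add: Q_def)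
  have Hnn: "H x s \<ge> 0" for x s
  proof (cases "s > 0 \<and> x > 0")
    case False then show ?thesis by (auto simp: H_def Q_def zero_less_mult_iff)
  qed (simp add: H_def Q_nonneg)
  have [measurable]: "(\<lambda>(x, s). ennreal (H x s)) \<in> borel_measurable (lborel \<Otimes>\<^sub>M lborel)"
    unfolding H_def by measurable
  have Hs: "(\<integral>\<^sup>+s. H x s \<partial>lborel) = ennreal (indicator {0<..} x * (x powr ((real n + 1) - 1) * exp (- x)))" for x
  proof (cases "x > 0")
    case True
    note L = laplace_Pd[OF True zero_less_one]
    have eq: "H x s = x ^ n * (indicat_real {0<..} s *\<^sub>R (exp (- 1 * s) * (Pd 0 (x * s powr (- \<nu>)) / s)))" for s
      using True by (auto simp: H_def Q_def indicator_def zero_less_mult_iff)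
    have i: "integrable lborel (H x)" "(\<integral>s. H x s \<partial>lborel) = x ^ n * exp (- x)"
      unfolding eq[abs_def] integral_mult_right_zero
      using L(1) L(2) by (auto simp only: set_integrable_def set_lebesgue_integral_def powr_one_eq_one mult_1_right intro!: integrable_mult_right)
    have "(\<integral>\<^sup>+s. H x s \<partial>lborel) = ennreal (x ^ n * exp (- x))"
      using nn_integral_eq_integral[OF i(1)] Hnn i(2) by simp
    then show ?thesis using True by (simp add: powr_realpow)
  next
    case False
    then have "H x s = 0" for s by (auto simp: H_def Q_def indicator_def zero_less_mult_iff)
    then show ?thesis using False by simp
  qed
  have Hx: "(\<integral>\<^sup>+x. H x s \<partial>lborel) = ennreal (indicator {0<..} s * (s powr (\<nu> * (real n + 1) - 1) * exp (- s))) * c" for s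
  proof (cases "s > 0")
    case True
    have "(\<integral>\<^sup>+x. H x s \<partial>lborel) = s powr \<nu> * (\<integral>\<^sup>+z. H (s powr \<nu> * z) s \<partial>lborel)"
      using True by (subst nn_integral_real_affine[of _ "s powr \<nu>" 0]) (auto simp: H_def)
    also have "(\<integral>\<^sup>+z. H (s powr \<nu> * z) s \<partial>lborel) = (\<integral>\<^sup>+z. ennreal (exp (- s) / s * (s powr \<nu>) ^ n) * ennreal (z ^ n * Q z) \<partial>lborel)"
    proof (intro nn_integral_cong)
      fix z
      have "s powr \<nu> * z * s powr (- \<nu>) = z" using True by (simp add: powr_minus)
      then have "H (s powr \<nu> * z) s = indicator {0<..} s * (exp (- s) / s) * ((s powr \<nu> * z) ^ n * Q z)"
        unfolding H_def by (simp only:)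
      then show "ennreal (H (s powr \<nu> * z) s) = ennreal (exp (- s) / s * (s powr \<nu>) ^ n) * ennreal (z ^ n * Q z)"
        using True zQ[of z] by (simp add: ennreal_mult[symmetric] power_mult_distrib mult_ac)
    qed
    also have "\<dots> = ennreal (exp (- s) / s * (s powr \<nu>) ^ n) * c"
      unfolding c_def by (rule nn_integral_cmult) measurable
    also have "s powr \<nu> * (ennreal (exp (- s) / s * (s powr \<nu>) ^ n) * c) = ennreal (s powr \<nu> * (exp (- s) / s * (s powr \<nu>) ^ n)) * c"
    proof -
      have "ennreal (s powr \<nu> * (exp (- s) / s * (s powr \<nu>) ^ n)) = ennreal (s powr \<nu>) * ennreal (exp (- s) / s * (s powr \<nu>) ^ n)"
        using True by (intro ennreal_mult) auto
      then show ?thesis by (metis mult.assoc)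
    qed
    also have "s powr \<nu> * (exp (- s) / s * (s powr \<nu>) ^ n) = s powr (\<nu> * (real n + 1) - 1) * exp (- s)"
      using True by (simp add: powr_power powr_diff ring_distribs powr_add mult_ac)
    finally show ?thesis using True by simp
  qed (simp add: H_def)
  have "ennreal (fact n) = (\<integral>\<^sup>+x. \<integral>\<^sup>+s. H x s \<partial>lborel \<partial>lborel)"
    unfolding Hs using Gamma_fact[where 'a = real, of n] by (subst nn_integral_Gamma) (auto simp: add.commute)
  also have "\<dots> = (\<integral>\<^sup>+s. \<integral>\<^sup>+x. H x s \<partial>lborel \<partial>lborel)" by (rule lborel_pair.Fubini'[symmetric]) measurable
  also have "\<dots> = ennreal (Gamma (\<nu> * (real n + 1))) * c"
    unfolding Hx using nu_pos by (subst nn_integral_multc) (auto simp: nn_integral_Gamma)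
  finally have e: "ennreal (fact n) = ennreal (Gamma (\<nu> * (real n + 1))) * c" .
  have G: "Gamma (\<nu> * (real n + 1)) > 0" using nu_pos by (intro Gamma_real_pos) auto
  have "c = ennreal (fact n / Gamma (\<nu> * (real n + 1)))"
  proof (cases c)
    case (real r)
    then have "fact n = Gamma (\<nu> * (real n + 1)) * r"
      using e G by (simp add: ennreal_mult[symmetric])
    then show ?thesis using real G by (simp add: field_simps)
  next
    case top
    then show ?thesis using e G by (simp add: ennreal_mult_top)
  qed
  then show "(\<integral>\<^sup>+z. ennreal (z ^ n * Q z) \<partial>lborel) = ennreal (fact n / Gamma (\<nu> * (real n + 1)))"
    by (simp add: c_def)
  show "AE z in lborel. 0 \<le> z ^ n * Q z" using zQ by simp
  show "0 \<le> fact n / Gamma (\<nu> * (real n + 1))" using G by simp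
qed measurable

lemma Q_integrable: "integrable lborel Q"
  using Q_moment[of 0] by (simp add: has_bochner_integral_iff)

text \<open>With \<open>\<phi> s = s * \<psi> s\<close> this says that the Caputo derivative of \<open>t \<mapsto> E (f (L\<^sub>t))\<close>, whose ordinary
  derivative is \<open>r\<^sup>\<nu>\<^sup>-\<^sup>1 \<integral> f' (z r\<^sup>\<nu>) P z dz\<close>, is \<open>E (f' (L\<^sub>t))\<close>, for \<open>f' = \<phi>\<close>. Both sides are integrals of \<open>\<psi>\<close>
  against measures on the half line with the same moments.\<close>

lemma abel_integral_Q:
  fixes \<psi> :: "real \<Rightarrow> real"
  assumes t: "t > 0" and cont: "continuous_on {0..} \<psi>" and lim: "(\<psi> \<longlongrightarrow> 0) at_top"
  defines "D \<equiv> \<lambda>r. r powr (\<nu> - 1) * (\<integral>z. z * r powr \<nu> * \<psi> (z * r powr \<nu>) * Q z \<partial>lborel)"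
  shows "set_integrable lborel {0<..<t} (\<lambda>r. (t - r) powr (- \<nu>) * D r)"
    and "(LBINT r:{0<..<t}. (t - r) powr (- \<nu>) * D r)
      = Gamma (1 - \<nu>) / \<nu> * t powr \<nu> * (\<integral>z. \<psi> (z * t powr \<nu>) * Q z \<partial>lborel)"
proof -
  define C where "C = Gamma (1 - \<nu>) / \<nu> * t powr \<nu>"
  define m where "m n = C * t powr (\<nu> * real n) * (fact n / Gamma (\<nu> * (real n + 1)))" for n :: nat
  define f1 where "f1 z = C * Q z" for z
  define Z1 where "Z1 z = max 0 z * t powr \<nu>" for z :: real
  define w where "w r = indicator {0<..<t} r * ((t - r) powr (- \<nu>) * r powr (2 * \<nu> - 1))" for r :: real
  define f2 where "f2 = (\<lambda>(r, z). w r * (z * Q z))"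
  define Z2 where "Z2 = (\<lambda>(r, z). max 0 z * r powr \<nu>)"
  have C: "C > 0" using t nu_pos nu_less_1 by (simp add: C_def Gamma_real_pos)
  have zQ: "z * Q z \<ge> 0" for z by (cases "z > 0") (auto simp: Q_nonneg, simp add: Q_def)
  have w: "w r \<ge> 0" for r by (simp add: w_def)
  have [measurable]: "w \<in> borel_measurable borel" unfolding w_def[abs_def] by measurable
  have mom1: "has_bochner_integral lborel (\<lambda>z. Z1 z ^ n * f1 z) (m n)" for n
  proof -
    have e: "Z1 z ^ n * f1 z = (C * t powr (\<nu> * real n)) * (z ^ n * Q z)" for z
      using t by (cases "z > 0") (auto simp: Z1_def f1_def power_mult_distrib powr_power mult_ac, auto simp: Q_def)
    show ?thesis unfolding e m_def by (intro has_bochner_integral_mult_right Q_moment)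
  qed
  have mom2: "has_bochner_integral (lborel \<Otimes>\<^sub>M lborel) (\<lambda>x. Z2 x ^ n * f2 x) (m n)" for n
  proof (rule has_bochner_integral_nn_integral)
    define b where "b = \<nu> * (real n + 2)"
    have b: "b > 0" using nu_pos by (simp add: b_def)
    define W where "W r = indicator {0<..<t} r * ((t - r) powr ((1 - \<nu>) - 1) * r powr (b - 1))" for r :: real
    have e: "Z2 (r, z) ^ n * f2 (r, z) = W r * (z ^ Suc n * Q z)" for r z
    proof (cases "r > 0 \<and> r < t \<and> z > 0")
      case True
      then have "(r powr \<nu>) ^ n * r powr (2 * \<nu> - 1) = r powr (b - 1)"
        by (simp add: powr_power powr_add[symmetric] b_def algebra_simps)
      then show ?thesis using True by (simp add: Z2_def f2_def w_def W_def power_mult_distrib mult_ac)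
    qed (auto simp: Z2_def f2_def w_def W_def Q_def indicator_def)
    have znn: "z ^ Suc n * Q z \<ge> 0" for z by (cases "z > 0") (auto simp: Q_nonneg, simp add: Q_def)
    show "(\<lambda>x. Z2 x ^ n * f2 x) \<in> borel_measurable (lborel \<Otimes>\<^sub>M lborel)"
      unfolding Z2_def f2_def by measurable
    show "AE x in lborel \<Otimes>\<^sub>M lborel. 0 \<le> Z2 x ^ n * f2 x"
      using mult_nonneg_nonneg[OF w zQ] by (auto simp: Z2_def f2_def intro!: AE_I2 mult_nonneg_nonneg[of "_ ^ n"])
    have G: "Gamma (\<nu> * (real n + 1)) > 0" "Gamma (\<nu> * (real n + 2)) > 0" "Gamma (1 - \<nu>) > 0"
      using nu_pos nu_less_1 by (auto intro!: Gamma_real_pos)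
    show "0 \<le> m n" using C G by (simp add: m_def)
    have [measurable]: "W \<in> borel_measurable borel" unfolding W_def[abs_def] by measurable
    have "(\<integral>\<^sup>+x. ennreal (Z2 x ^ n * f2 x) \<partial>(lborel \<Otimes>\<^sub>M lborel)) = (\<integral>\<^sup>+x. (case x of (r, z) \<Rightarrow> ennreal (W r) * ennreal (z ^ Suc n * Q z)) \<partial>(lborel \<Otimes>\<^sub>M lborel))"
    proof (intro nn_integral_cong)
      fix x :: "real \<times> real"
      show "ennreal (Z2 x ^ n * f2 x) = (case x of (r, z) \<Rightarrow> ennreal (W r) * ennreal (z ^ Suc n * Q z))"
        using e[of "fst x" "snd x"] znn[of "snd x"] by (cases x) (simp add: ennreal_mult'')
    qed
    also have "\<dots> = (\<integral>\<^sup>+r. \<integral>\<^sup>+z. ennreal (W r) * ennreal (z ^ Suc n * Q z) \<partial>lborel \<partial>lborel)"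
      by (subst lborel.nn_integral_fst[symmetric]) auto
    also have "\<dots> = (\<integral>\<^sup>+r. ennreal (W r) * ennreal (fact (Suc n) / Gamma (\<nu> * (real (Suc n) + 1))) \<partial>lborel)"
    proof (intro nn_integral_cong)
      fix r
      have "(\<integral>\<^sup>+z. ennreal (z ^ Suc n * Q z) \<partial>lborel) = ennreal (fact (Suc n) / Gamma (\<nu> * (real (Suc n) + 1)))"
        using Q_moment[of "Suc n"] znn by (subst nn_integral_eq_integral) (auto simp: has_bochner_integral_iff)
      then show "(\<integral>\<^sup>+z. ennreal (W r) * ennreal (z ^ Suc n * Q z) \<partial>lborel) = ennreal (W r) * ennreal (fact (Suc n) / Gamma (\<nu> * (real (Suc n) + 1)))"
        by (subst nn_integral_cmult) auto
    qed
    also have "\<dots> = ennreal (t powr (b + (1 - \<nu>) - 1) * Beta b (1 - \<nu>)) * ennreal (fact (Suc n) / Gamma (\<nu> * (real n + 2)))"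
      unfolding W_def using nn_integral_Beta[OF t b, of "1 - \<nu>"] nu_less_1
      by (subst nn_integral_multc) (auto simp: add.commute)
    also have "\<dots> = ennreal (t powr (b + (1 - \<nu>) - 1) * Beta b (1 - \<nu>) * (fact (Suc n) / Gamma (\<nu> * (real n + 2))))"
      using G by (intro ennreal_mult''[symmetric]) (auto intro!: divide_nonneg_pos)
    also have "t powr (b + (1 - \<nu>) - 1) * Beta b (1 - \<nu>) * (fact (Suc n) / Gamma (\<nu> * (real n + 2))) = m n"
    proof -
      have b1: "b + (1 - \<nu>) = \<nu> * (real n + 1) + 1" by (simp add: b_def algebra_simps)
      have "Gamma (\<nu> * (real n + 1) + 1) = \<nu> * (real n + 1) * Gamma (\<nu> * (real n + 1))"
      proof (rule Gamma_plus1)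
        have "\<nu> * (real n + 1) > 0" using nu_pos by simp
        then show "\<nu> * (real n + 1) \<notin> \<int>\<^sub>\<le>\<^sub>0" by (meson nonpos_Ints_nonpos not_le)
      qed
      then have B: "Beta b (1 - \<nu>) = Gamma (\<nu> * (real n + 2)) * Gamma (1 - \<nu>) / (\<nu> * (real n + 1) * Gamma (\<nu> * (real n + 1)))"
        unfolding Beta_def b1 by (simp add: b_def)
      have T: "t powr (b + (1 - \<nu>) - 1) = t powr \<nu> * t powr (\<nu> * real n)"
        unfolding b1 using t by (simp add: powr_add[symmetric] algebra_simps)
      have "Gamma (\<nu> * (real n + 2)) * Gamma (1 - \<nu>) / (\<nu> * (real n + 1) * Gamma (\<nu> * (real n + 1))) * (fact (Suc n) / Gamma (\<nu> * (real n + 2)))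
          = Gamma (1 - \<nu>) / \<nu> * (fact n / Gamma (\<nu> * (real n + 1)))"
      proof -
        have "g2 * g0 / (\<nu> * k * g1) * (k * fact n / g2) = g0 / \<nu> * (fact n / g1)"
          if "g1 > 0" "g2 > 0" "k > 0" for g0 g1 g2 k :: real
          using that nu_pos by (simp add: field_simps)
        moreover have "fact (Suc n) = (real n + 1) * fact n" by (simp add: algebra_simps)
        moreover have "real n + 1 > 0" by simp
        ultimately show ?thesis using G by metis
      qed
      then show ?thesis unfolding T B m_def C_def by (simp only: mult_ac)
    qed
    finally show "(\<integral>\<^sup>+x. ennreal (Z2 x ^ n * f2 x) \<partial>(lborel \<Otimes>\<^sub>M lborel)) = ennreal (m n)" .
  qed
  have summ: "summable (\<lambda>n. p ^ n / fact n * m n)" if "p \<ge> 0" for p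
  proof -
    have "summable (\<lambda>n. C * ((p * t powr \<nu>) ^ n / Gamma (\<nu> * (real n + 1))))"
      using that nu_pos by (intro summable_mult summable_power_div_Gamma) auto
    moreover have "C * ((p * t powr \<nu>) ^ n / Gamma (\<nu> * (real n + 1))) = p ^ n / fact n * m n" for n
      using t by (simp add: m_def power_mult_distrib powr_power mult_ac)
    ultimately show ?thesis by simp
  qed
  have conc: "integrable lborel (\<lambda>z. \<psi> (Z1 z) * f1 z)" 
      "integrable (lborel \<Otimes>\<^sub>M lborel) (\<lambda>x. \<psi> (Z2 x) * f2 x)"
      "(\<integral>z. \<psi> (Z1 z) * f1 z \<partial>lborel) = (\<integral>x. \<psi> (Z2 x) * f2 x \<partial>(lborel \<Otimes>\<^sub>M lborel))"
  proof -
    have m: "Z1 \<in> borel_measurable lborel" "Z2 \<in> borel_measurable (lborel \<Otimes>\<^sub>M lborel)"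
      unfolding Z1_def[abs_def] Z2_def by measurable
    have p: "f1 z \<ge> 0" "Z1 z \<ge> 0" "f2 x \<ge> 0" "Z2 x \<ge> 0" for z x
      using C Q_nonneg zQ w by (auto simp: f1_def Z1_def f2_def Z2_def split: prod.split)
    note R = integral_eq_of_moments_eq[OF p m mom1 mom2 summ cont lim]
    show "integrable lborel (\<lambda>z. \<psi> (Z1 z) * f1 z)" by (rule R(1))
    show "integrable (lborel \<Otimes>\<^sub>M lborel) (\<lambda>x. \<psi> (Z2 x) * f2 x)" by (rule R(2))
    show "(\<integral>z. \<psi> (Z1 z) * f1 z \<partial>lborel) = (\<integral>x. \<psi> (Z2 x) * f2 x \<partial>(lborel \<Otimes>\<^sub>M lborel))" by (rule R(3))
  qed
  have inner: "(\<integral>z. \<psi> (Z2 (r, z)) * f2 (r, z) \<partial>lborel) = indicator {0<..<t} r *\<^sub>R ((t - r) powr (- \<nu>) * D r)" for r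
  proof (cases "r \<in> {0<..<t}")
    case True
    have "r powr (2 * \<nu> - 1) = r powr (\<nu> - 1) * r powr \<nu>" by (simp add: powr_add[symmetric])
    then have "(\<integral>z. \<psi> (Z2 (r, z)) * f2 (r, z) \<partial>lborel) = (\<integral>z. ((t - r) powr (- \<nu>) * r powr (\<nu> - 1)) * (z * r powr \<nu> * \<psi> (z * r powr \<nu>) * Q z) \<partial>lborel)"
      using True by (intro Bochner_Integration.integral_cong refl) (auto simp: Z2_def f2_def w_def Q_def indicator_def max_def)
    then show ?thesis using True by (simp add: D_def)
  qed (simp add: f2_def w_def)
  have c2: "integrable (lborel \<Otimes>\<^sub>M lborel) (\<lambda>(r, z). \<psi> (Z2 (r, z)) * f2 (r, z))"
    using conc(2) by (simp add: case_prod_beta')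
  show "set_integrable lborel {0<..<t} (\<lambda>r. (t - r) powr (- \<nu>) * D r)"
    using lborel_pair.integrable_fst[OF c2] unfolding inner set_integrable_def .
  have "(LBINT r:{0<..<t}. (t - r) powr (- \<nu>) * D r) = (\<integral>x. \<psi> (Z2 x) * f2 x \<partial>(lborel \<Otimes>\<^sub>M lborel))"
    using lborel_pair.integral_fst[OF c2] unfolding inner set_lebesgue_integral_def by (simp add: case_prod_beta')
  also have "\<dots> = (\<integral>z. C * (\<psi> (z * t powr \<nu>) * Q z) \<partial>lborel)"
    unfolding conc(3)[symmetric]
    by (intro Bochner_Integration.integral_cong refl) (auto simp: Z1_def f1_def Q_def indicator_def)
  finally show "(LBINT r:{0<..<t}. (t - r) powr (- \<nu>) * D r)
      = Gamma (1 - \<nu>) / \<nu> * t powr \<nu> * (\<integral>z. \<psi> (z * t powr \<nu>) * Q z \<partial>lborel)"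
    by (simp add: C_def)
qed

end

section \<open>The inverse stable density\<close>

lemma stable_subordinator_AE_nonneg:
  assumes "stable_subordinator \<nu> M \<tau>" "t \<ge> 0"
  shows "AE \<omega> in M. \<tau> t \<omega> \<ge> 0"
proof -
  have "AE \<omega> in M. \<tau> 0 \<omega> = 0" "AE \<omega> in M. mono_on {0..} (\<lambda>t. \<tau> t \<omega>)"
    using assms(1) by (simp_all add: stable_subordinator_def levy_process_def)
  then show ?thesis
  proof eventually_elim
    case (elim \<omega>)
    then show ?case using assms(2) mono_onD[of "{0..}" "\<lambda>t. \<tau> t \<omega>" 0 t] by auto
  qed
qed

lemma laplace_density:
  assumes sub: "stable_subordinator \<nu> M \<tau>" and dens: "continuous_density_of M \<tau> h"
    and x: "x > 0" and r: "r > 0"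
  shows "set_integrable lborel {0<..} (\<lambda>s. exp (- r * s) * h s x)"
    and "(LBINT s:{0<..}. exp (- r * s) * h s x) = exp (- x * r powr \<nu>)"
proof -
  interpret prob_space M using sub by (simp add: stable_subordinator_def levy_process_def)
  have [measurable]: "\<tau> x \<in> borel_measurable M"
    using sub x by (simp add: stable_subordinator_def levy_process_def)
  have d: "distributed M lborel (\<tau> x) (\<lambda>s. ennreal (h s x))" and h: "\<And>s. h s x \<ge> 0"
    using dens x by (auto simp: continuous_density_of_def)
  have nn: "AE \<omega> in M. \<tau> x \<omega> \<ge> 0" using stable_subordinator_AE_nonneg[OF sub] x by simp
  define g where "g s = indicator {0..} s * exp (- r * s)" for s :: real
  have g [measurable]: "g \<in> borel_measurable lborel" unfolding g_def[abs_def] by measurable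
  have "integrable M (\<lambda>\<omega>. g (\<tau> x \<omega>))"
    by (rule integrable_const_bound[of _ 1]) (use r in \<open>auto simp: g_def indicator_def intro!: AE_I2\<close>)
  then have i: "integrable lborel (\<lambda>s. h s x * g s)"
    using distributed_integrable[OF d g] h by simp
  have "(\<integral>s. h s x * g s \<partial>lborel) = (\<integral>\<omega>. g (\<tau> x \<omega>) \<partial>M)"
    using distributed_integral[OF d g] h by simp
  also have "\<dots> = (\<integral>\<omega>. exp (- r * \<tau> x \<omega>) \<partial>M)"
    by (rule integral_cong_AE) (use nn in \<open>auto simp: g_def indicator_def elim!: eventually_mono\<close>)
  also have "\<dots> = exp (- x * r powr \<nu>)"
    using sub x r by (simp add: stable_subordinator_def)
  finally have e: "(\<integral>s. h s x * g s \<partial>lborel) = exp (- x * r powr \<nu>)" .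
  have ae: "AE s in lborel. h s x * g s = indicat_real {0<..} s *\<^sub>R (exp (- r * s) * h s x)"
    using AE_lborel_singleton[of 0] by eventually_elim (auto simp: g_def indicator_def)
  have hm: "(\<lambda>s. h s x) \<in> borel_measurable lborel"
    using distributed_real_measurable[OF _ d] h by simp
  then have m: "(\<lambda>s. indicat_real {0<..} s *\<^sub>R (exp (- r * s) * h s x)) \<in> borel_measurable lborel"
    by measurable
  have m': "(\<lambda>s. h s x * g s) \<in> borel_measurable lborel" using hm by measurable
  show "set_integrable lborel {0<..} (\<lambda>s. exp (- r * s) * h s x)"
    unfolding set_integrable_def using i integrable_cong_AE[OF m' m ae] by simp
  show "(LBINT s:{0<..}. exp (- r * s) * h s x) = exp (- x * r powr \<nu>)"
    unfolding set_lebesgue_integral_def using e integral_cong_AE[OF m' m ae] by simp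
qed

context stable_index
begin

lemma density_eq:
  assumes sub: "stable_subordinator \<nu> M \<tau>" and dens: "continuous_density_of M \<tau> h"
    and x: "x > 0" and s: "s > 0"
  shows "h s x = Pd 0 (x * s powr (- \<nu>)) / s"
proof -
  define k where "k s = Pd 0 (x * s powr (- \<nu>)) / s" for s
  have kc: "continuous_on {0<..} k" unfolding k_def using x
    by (intro continuous_intros continuous_on_compose2[OF Pd_continuous_on[of 0]]) auto
  have hc: "continuous_on {0<..} (\<lambda>s. h s x)" using dens x by (auto simp: continuous_density_of_def)
  note L = laplace_density[OF sub dens x] and K = laplace_Pd[OF x, folded k_def]
  have "(\<lambda>s. h s x - k s) s = 0"
  proof (rule continuous_zero_of_laplace_zero[OF _ _ _ s])
    show "continuous_on {0<..} (\<lambda>s. h s x - k s)" by (intro continuous_intros hc kc)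
    show "set_integrable lborel {0<..} (\<lambda>s. exp (- s) * (h s x - k s))"
      using set_integral_diff(1)[OF L(1)[of 1] K(1)[of 1]] by (simp add: right_diff_distrib)
    show "(LBINT s:{0<..}. exp (- (real n + 1) * s) * (h s x - k s)) = 0" for n
    proof -
      have p: "real n + 1 > 0" by simp
      show ?thesis
        using set_integral_diff(2)[OF L(1)[OF p] K(1)[OF p]] L(2)[OF p] K(2)[OF p]
        by (simp add: right_diff_distrib)
    qed
  qed
  then show ?thesis by (simp add: k_def)
qed

lemma inverse_density_eq:
  assumes h: "\<And>s x. s > 0 \<Longrightarrow> x > 0 \<Longrightarrow> h s x = Pd 0 (x * s powr (- \<nu>)) / s"
    and s: "s > 0" and t: "t > 0"
  shows "inverse_density h s t = Pd 0 (s * t powr (- \<nu>)) / (\<nu> * s)"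
proof -
  define f where "f r = Pd 1 (s * r powr (- \<nu>)) * r powr (- \<nu> - 1)" for r
  have der: "deriv (\<lambda>y. h r y) s = f r" if r: "r > 0" for r
  proof -
    have "(Pd 0 has_real_derivative Pd 1 (s * r powr (- \<nu>))) (at (s * r powr (- \<nu>)))"
      using Pd_deriv[of "s * r powr (- \<nu>)" 0] r s by simp
    then have "((\<lambda>y. Pd 0 (y * r powr (- \<nu>)) / r) has_real_derivative Pd 1 (s * r powr (- \<nu>)) * r powr (- \<nu>) / r) (at s)"
      by (intro DERIV_cdivide DERIV_chain2[where f = "Pd 0"]) (auto intro!: derivative_eq_intros)
    moreover have "eventually (\<lambda>y. h r y = Pd 0 (y * r powr (- \<nu>)) / r) (nhds s)"
      using eventually_nhds_in_open[of "{0<..}" s] s by (auto elim!: eventually_mono simp: h r)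
    ultimately have "((\<lambda>y. h r y) has_real_derivative Pd 1 (s * r powr (- \<nu>)) * r powr (- \<nu>) / r) (at s)"
      by (subst DERIV_cong_ev[OF refl _ refl]) auto
    then show ?thesis using r by (simp add: DERIV_imp_deriv f_def powr_diff)
  qed
  have contf: "continuous_on {0<..} f"
    unfolding f_def using s
    by (intro continuous_intros continuous_on_compose2[OF Pd_continuous_on[of 1]]) auto
  have eint: "einterval t \<infinity> = {t<..}" by (auto simp: einterval_def)
  have pint: "set_integrable lborel {t<..} (\<lambda>r. r powr (- \<nu> - 1))"
    unfolding eint[symmetric]
  proof (rule interval_integral_FTC_nonneg)
    show "((\<lambda>r. - (r powr (- \<nu>)) / \<nu>) has_real_derivative r powr (- \<nu> - 1)) (at r)" if "ereal t < ereal r" for r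
      using that t nu_pos by (auto intro!: derivative_eq_intros)
    show "isCont (\<lambda>r. r powr (- \<nu> - 1)) r" if "ereal t < ereal r" for r
      using that t by (intro continuous_intros) auto
    have "((\<lambda>r. - (r powr (- \<nu>)) / \<nu>) \<longlongrightarrow> - (t powr (- \<nu>)) / \<nu>) (at_right t)"
      using t nu_pos by (intro tendsto_intros) auto
    then show "(((\<lambda>r. - (r powr (- \<nu>)) / \<nu>) \<circ> real_of_ereal) \<longlongrightarrow> - (t powr (- \<nu>)) / \<nu>) (at_right (ereal t))"
      by (simp add: ereal_tendsto_simps)
    show "(((\<lambda>r. - (r powr (- \<nu>)) / \<nu>) \<circ> real_of_ereal) \<longlongrightarrow> 0) (at_left \<infinity>)"
      unfolding ereal_tendsto_simps using nu_pos by real_asymp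
  qed auto
  have "continuous_on {t<..} f" by (rule continuous_on_subset[OF contf]) (use t in auto)
  then have mf: "(\<lambda>r. indicator {t<..} r *\<^sub>R f r) \<in> borel_measurable borel"
    by (intro borel_measurable_continuous_on_indicator) auto
  obtain C where C: "\<And>w k. w \<ge> 0 \<Longrightarrow> k \<le> 2 \<Longrightarrow> \<bar>Pd k w\<bar> \<le> C" using Pd_bounded by blast
  have fint: "set_integrable lborel {t<..} f"
    unfolding set_integrable_def
  proof (rule Bochner_Integration.integrable_bound)
    show "integrable lborel (\<lambda>r. C * (indicat_real {t<..} r *\<^sub>R r powr (- \<nu> - 1)))"
      using pint by (intro integrable_mult_right) (simp add: set_integrable_def)
    show "AE r in lborel. norm (indicat_real {t<..} r *\<^sub>R f r) \<le> norm (C * (indicat_real {t<..} r *\<^sub>R r powr (- \<nu> - 1)))"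
    proof (rule AE_I2)
      fix r
      show "norm (indicat_real {t<..} r *\<^sub>R f r) \<le> norm (C * (indicat_real {t<..} r *\<^sub>R r powr (- \<nu> - 1)))"
        using C[of "s * r powr (- \<nu>)" 1] C[of 0 0] s
        by (auto simp: f_def abs_mult indicator_def intro!: mult_right_mono)
    qed
  qed (use mf in simp)
  have FTC: "(LBINT r=t..\<infinity>. f r) = 0 - (- Pd 0 (s * t powr (- \<nu>)) / (\<nu> * s))"
  proof (rule interval_integral_FTC_integrable)
    define F where "F r = - Pd 0 (s * r powr (- \<nu>)) / (\<nu> * s)" for r
    have dF: "(F has_real_derivative f r) (at r)" if r: "r > 0" for r
    proof -
      have "(Pd 0 has_real_derivative Pd 1 (s * r powr (- \<nu>))) (at (s * r powr (- \<nu>)))"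
        using Pd_deriv[of "s * r powr (- \<nu>)" 0] r s by simp
      moreover have "((\<lambda>r. s * r powr (- \<nu>)) has_real_derivative s * (- \<nu> * r powr (- \<nu> - 1))) (at r)"
        using r by (auto intro!: derivative_eq_intros)
      ultimately have "((\<lambda>r. Pd 0 (s * r powr (- \<nu>))) has_real_derivative
          Pd 1 (s * r powr (- \<nu>)) * (s * (- \<nu> * r powr (- \<nu> - 1)))) (at r)"
        by (rule DERIV_chain2)
      then show ?thesis unfolding F_def f_def using s nu_pos
        by (auto intro!: derivative_eq_intros)
    qed
    then show "(F has_vector_derivative f r) (at r)" if "ereal t < ereal r" for r
      using that t by (auto simp: has_real_derivative_iff_has_vector_derivative[symmetric])
    show "isCont f r" if "ereal t < ereal r" for r
      using that t contf by (simp add: continuous_on_eq_continuous_at)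
    show "set_integrable lborel (einterval t \<infinity>) f" unfolding eint by (rule fint)
    have "isCont F t" using dF[OF t] by (rule DERIV_isCont)
    then have "(F \<longlongrightarrow> F t) (at_right t)" unfolding isCont_def by (rule filterlim_mono) (auto simp: at_le)
    then show "((F \<circ> real_of_ereal) \<longlongrightarrow> - Pd 0 (s * t powr (- \<nu>)) / (\<nu> * s)) (at_right (ereal t))"
      by (simp add: ereal_tendsto_simps F_def)
    have "filterlim (\<lambda>r. s * r powr (- \<nu>)) (at_right 0) at_top"
      using s nu_pos by real_asymp
    then have "((\<lambda>r. Pd 0 (s * r powr (- \<nu>))) \<longlongrightarrow> 0) at_top"
      by (rule filterlim_compose[OF Pd_0_tendsto])
    then have "(F \<longlongrightarrow> - 0 / (\<nu> * s)) at_top"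
      unfolding F_def using s nu_pos by (intro tendsto_intros) auto
    then show "((F \<circ> real_of_ereal) \<longlongrightarrow> 0) (at_left \<infinity>)" by (simp add: ereal_tendsto_simps)
  qed simp
  have "inverse_density h s t = (LBINT r:{t<..}. f r)"
    unfolding inverse_density_def by (rule set_lebesgue_integral_cong) (use der t in auto)
  also have "\<dots> = (LBINT r=t..\<infinity>. f r)" by (simp add: interval_lebesgue_integral_def eint)
  finally show ?thesis unfolding FTC by simp
qed

end

section \<open>The fractional equation\<close>

definition q :: "real \<Rightarrow> real \<Rightarrow> real \<Rightarrow> real" where
  "q \<beta> x s = s powr (- \<beta>) * exp (- x\<^sup>2 / s)"

lemma g_tilde_eq: "g_tilde \<mu> x s = 2 / Gamma \<mu> * x powr (2 * \<mu> - 1) * q \<mu> x s"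
  by (simp add: g_tilde_def q_def powr_minus divide_inverse mult_ac)

lemma q_nonneg: "q \<beta> x s \<ge> 0"
  by (simp add: q_def)

lemma q_measurable [measurable]: "q \<beta> x \<in> borel_measurable borel"
  unfolding q_def[abs_def] by measurable

lemma q_shift: "s > 0 \<Longrightarrow> q \<beta> x s = s * q (\<beta> + 1) x s"
  by (simp add: q_def powr_mult_base flip: mult.assoc)

lemma q_deriv_x: "s > 0 \<Longrightarrow> ((\<lambda>x. q \<beta> x s) has_real_derivative - 2 * x * q (\<beta> + 1) x s) (at x)"
  unfolding q_def by (auto intro!: derivative_eq_intros simp: powr_diff[of s "- \<beta>" 1, simplified])

lemma q_deriv_s:
  "s > 0 \<Longrightarrow> (q \<beta> x has_real_derivative - \<beta> * q (\<beta> + 1) x s + x\<^sup>2 * q (\<beta> + 2) x s) (at s)"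
  unfolding q_def
  by (auto intro!: derivative_eq_intros simp: powr_diff[of s "- \<beta>" 1, simplified] powr_diff[of s "- \<beta>" 2, simplified]
      powr_numeral power2_eq_square divide_simps)

lemma q_bounded:
  assumes \<beta>: "\<beta> > 0" and c: "c > 0"
  shows "\<exists>K\<ge>0. \<forall>x s. x \<ge> c \<longrightarrow> s > 0 \<longrightarrow> q \<beta> x s \<le> K"
proof (intro exI conjI allI impI)
  fix x s :: real assume x: "x \<ge> c" and s: "s > 0"
  define v where "v = c\<^sup>2 / s"
  have v: "v > 0" using c s by (simp add: v_def)
  have "c\<^sup>2 \<le> x\<^sup>2" using x c by (intro power_mono) auto
  then have "exp (- x\<^sup>2 / s) \<le> exp (- v)" using s by (simp add: v_def divide_right_mono)
  then have "q \<beta> x s \<le> s powr (- \<beta>) * exp (- v)" unfolding q_def by (intro mult_left_mono) auto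
  also have "s powr (- \<beta>) = (c\<^sup>2) powr (- \<beta>) * v powr \<beta>"
    using c s by (simp add: v_def powr_divide powr_minus field_simps)
  also have "(c\<^sup>2) powr (- \<beta>) * v powr \<beta> * exp (- v) \<le> (c\<^sup>2) powr (- \<beta>) * exp (\<beta> * ln \<beta> - \<beta>)"
  proof -
    have "ln (v / \<beta>) \<le> v / \<beta> - 1" using v \<beta> by (intro ln_le_minus_one) auto
    then have "\<beta> * (ln v - ln \<beta>) \<le> \<beta> * (v / \<beta> - 1)" using v \<beta> by (intro mult_left_mono) (auto simp: ln_div)
    then have "\<beta> * ln v - v \<le> \<beta> * ln \<beta> - \<beta>" using \<beta> by (simp add: algebra_simps)
    then have "exp (\<beta> * ln v - v) \<le> exp (\<beta> * ln \<beta> - \<beta>)" by simp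
    moreover have "v powr \<beta> * exp (- v) = exp (\<beta> * ln v - v)" using v by (simp add: powr_def exp_diff exp_minus divide_inverse)
    ultimately have "v powr \<beta> * exp (- v) \<le> exp (\<beta> * ln \<beta> - \<beta>)" by simp
    then show ?thesis by (simp only: mult.assoc) (intro mult_left_mono, auto)
  qed
  finally show "q \<beta> x s \<le> (c\<^sup>2) powr (- \<beta>) * exp (\<beta> * ln \<beta> - \<beta>)" .
qed simp

lemma q_continuous_on:
  assumes \<beta>: "\<beta> > 0" and x: "x > 0"
  shows "continuous_on {0..} (q \<beta> x)"
  unfolding continuous_on_eq_continuous_within
proof
  fix s :: real assume s: "s \<in> {0..}"
  show "continuous (at s within {0..}) (q \<beta> x)"
  proof (cases "s = 0")
    case False
    then have "s > 0" using s by auto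
    then have "isCont (q \<beta> x) s" using DERIV_isCont[OF q_deriv_s] by blast
    then show ?thesis by (rule continuous_at_imp_continuous_at_within)
  next
    case True
    obtain K where K: "\<And>s. s > 0 \<Longrightarrow> q (\<beta> + 1) x s \<le> K"
      using q_bounded[of "\<beta> + 1" x] \<beta> x by auto
    have "(q \<beta> x \<longlongrightarrow> 0) (at 0 within {0..})"
    proof (rule Lim_null_comparison)
      show "((\<lambda>s. s * K) \<longlongrightarrow> 0) (at 0 within {0..})" by (auto intro!: tendsto_eq_intros)
      show "eventually (\<lambda>s. norm (q \<beta> x s) \<le> s * K) (at 0 within {0..})"
        unfolding eventually_at_filter
      proof (rule always_eventually, safe)
        fix s :: real assume "s \<noteq> 0" "0 \<le> s"
        then have "s > 0" by simp
        then show "norm (q \<beta> x s) \<le> s * K" using K[of s] q_nonneg[of \<beta> x s]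
          by (simp add: q_shift[of s \<beta>] abs_of_nonneg)
      qed
    qed
    then show ?thesis using True by (simp add: continuous_within q_def)
  qed
qed

lemma q_tendsto_0:
  assumes \<beta>: "\<beta> > 0" shows "(q \<beta> x \<longlongrightarrow> 0) at_top"
proof (rule Lim_null_comparison)
  show "((\<lambda>s::real. s powr (- \<beta>)) \<longlongrightarrow> 0) at_top" using \<beta> by real_asymp
  show "eventually (\<lambda>s. norm (q \<beta> x s) \<le> s powr (- \<beta>)) at_top"
    using eventually_gt_at_top[of 0]
    by eventually_elim (auto simp: q_def abs_mult intro!: mult_left_le)
qed

lemma bessel_operator_identity:
  fixes u w0 w1 w2 :: "real \<Rightarrow> real"
  assumes u: "\<And>y. y > 0 \<Longrightarrow> u y = k * (y powr (2 * \<mu> - 1) * w0 y)"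
    and d0: "\<And>y. y > 0 \<Longrightarrow> (w0 has_real_derivative - 2 * y * w1 y) (at y)"
    and d1: "\<And>y. y > 0 \<Longrightarrow> (w1 has_real_derivative - 2 * y * w2 y) (at y)"
    and x: "x > 0"
  shows "u differentiable (at x)" "deriv u differentiable (at x)"
    and "1 / 2 ^ 2 * (deriv (deriv u) x - deriv (\<lambda>y. (2 * \<mu> - 1) / y * u y) x)
      = k * x powr (2 * \<mu> - 1) * (- \<mu> * w1 x + x\<^sup>2 * w2 x)"
proof -
  define m where "m = 2 * \<mu> - 1"
  have ev: "eventually (\<lambda>y. y \<in> {0<..}) (nhds y)" if "y > 0" for y :: real
    using that by (intro eventually_nhds_in_open) auto
  define u' where "u' y = k * (m * y powr (m - 1) * w0 y - 2 * y powr (m + 1) * w1 y)" for y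
  have du: "(u has_real_derivative u' y) (at y)" if y: "y > 0" for y
  proof -
    have "((\<lambda>y. k * (y powr m * w0 y)) has_real_derivative u' y) (at y)"
      using y by (auto intro!: derivative_eq_intros d0 simp: u'_def powr_add)
    moreover have "eventually (\<lambda>y. u y = k * (y powr m * w0 y)) (nhds y)"
      using ev[OF y] by (auto elim!: eventually_mono simp: u m_def)
    ultimately show ?thesis by (subst DERIV_cong_ev[OF refl _ refl]) auto
  qed
  define u'' where "u'' = k * (m * ((m - 1) * x powr (m - 2) * w0 x - 2 * x powr m * w1 x)
      - 2 * ((m + 1) * x powr m * w1 x - 2 * x powr (m + 2) * w2 x))"
  have "(u' has_real_derivative u'') (at x)"
  proof -
    have dp: "((\<lambda>y. y powr c) has_real_derivative c * x powr (c - 1)) (at x)" for c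
      using x by (rule has_real_derivative_powr)
    have dm: "((\<lambda>y. c * y powr e * w y) has_real_derivative c * (e * x powr (e - 1) * w x + x powr e * w')) (at x)"
      if "(w has_real_derivative w') (at x)" for c e w w'
      using DERIV_cmult[OF DERIV_mult'[OF dp that], of c e] by (simp add: algebra_simps)
    have "(u' has_real_derivative k * (m * ((m - 1) * x powr (m - 1 - 1) * w0 x + x powr (m - 1) * (- 2 * x * w1 x))
        - 2 * ((m + 1) * x powr (m + 1 - 1) * w1 x + x powr (m + 1) * (- 2 * x * w2 x)))) (at x)"
      unfolding u'_def by (intro DERIV_cmult DERIV_diff dm d0 d1 x)
    moreover have "k * (m * ((m - 1) * x powr (m - 1 - 1) * w0 x + x powr (m - 1) * (- 2 * x * w1 x))
        - 2 * ((m + 1) * x powr (m + 1 - 1) * w1 x + x powr (m + 1) * (- 2 * x * w2 x))) = u''"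
      unfolding u''_def using x by (simp add: powr_diff powr_add powr_numeral field_simps power2_eq_square)
    ultimately show ?thesis by simp
  qed
  moreover have "eventually (\<lambda>y. deriv u y = u' y) (nhds x)"
    using ev[OF x] by (auto elim!: eventually_mono intro!: DERIV_imp_deriv du)
  ultimately have d2: "(deriv u has_real_derivative u'') (at x)"
    by (subst DERIV_cong_ev[OF refl _ refl]) auto
  have "((\<lambda>y. m / y * u y) has_real_derivative (m / x * u' x - m / x\<^sup>2 * u x)) (at x)"
    using x by (auto intro!: derivative_eq_intros du simp: power2_eq_square field_simps)
  then have d3: "deriv (\<lambda>y. m / y * u y) x = m / x * u' x - m / x\<^sup>2 * u x" by (rule DERIV_imp_deriv)
  show "u differentiable (at x)" "deriv u differentiable (at x)"
    using du[OF x] d2 by (auto simp: real_differentiable_def)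
  have p: "x powr (m - 1) = x powr m / x" "x powr (m - 2) = x powr m / x\<^sup>2" "x powr (m + 1) = x powr m * x"
    "x powr (m + 2) = x powr m * x\<^sup>2" using x by (simp_all add: powr_diff powr_add powr_numeral)
  have m: "\<mu> = (m + 1) / 2" by (simp add: m_def)
  have "1 / 2 ^ 2 * (u'' - (m / x * u' x - m / x\<^sup>2 * u x)) = k * x powr m * (- \<mu> * w1 x + x\<^sup>2 * w2 x)"
    unfolding u''_def u'_def u[OF x] m_def[symmetric] p unfolding m using x
    by (simp add: field_simps power2_eq_square)
  then show "1 / 2 ^ 2 * (deriv (deriv u) x - deriv (\<lambda>y. (2 * \<mu> - 1) / y * u y) x)
      = k * x powr (2 * \<mu> - 1) * (- \<mu> * w1 x + x\<^sup>2 * w2 x)"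
    using DERIV_imp_deriv[OF d2] d3 by (simp only: m_def)
qed

context stable_positive
begin

definition V :: "real \<Rightarrow> real \<Rightarrow> real \<Rightarrow> real" where
  "V \<beta> x t = (\<integral>z. q \<beta> x (z * t powr \<nu>) * Q z \<partial>lborel)"

lemma Q_eq_0: "z \<le> 0 \<Longrightarrow> Q z = 0"
  by (simp add: Q_def)

lemma q_Q_bound:
  assumes K: "\<And>s. s > 0 \<Longrightarrow> q \<beta> x s \<le> K" and t: "t > 0"
  shows "\<bar>q \<beta> x (z * t powr \<nu>) * Q z\<bar> \<le> K * Q z"
  using K[of "z * t powr \<nu>"] q_nonneg[of \<beta> x] Q_nonneg[of z] t
  by (cases "z > 0") (auto simp: abs_mult Q_eq_0 intro!: mult_right_mono)

lemma V_integrable: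
  assumes "\<beta> > 0" "x > 0" "t > 0"
  shows "integrable lborel (\<lambda>z. q \<beta> x (z * t powr \<nu>) * Q z)"
proof -
  obtain K where K: "\<And>s. s > 0 \<Longrightarrow> q \<beta> x s \<le> K" "K \<ge> 0"
    using q_bounded[OF assms(1,2)] by auto
  show ?thesis
  proof (rule Bochner_Integration.integrable_bound)
    show "integrable lborel (\<lambda>z. K * Q z)" by (intro integrable_mult_right Q_integrable)
    show "AE z in lborel. norm (q \<beta> x (z * t powr \<nu>) * Q z) \<le> norm (K * Q z)"
      using q_Q_bound[OF K(1) assms(3)] by (auto intro!: AE_I2 order.trans[OF _ abs_ge_self] simp del: abs_mult)
  qed measurable
qed

lemma V_deriv_x:
  assumes "\<beta> > 0" "x > 0" "t > 0"
  shows "((\<lambda>x. V \<beta> x t) has_real_derivative - 2 * x * V (\<beta> + 1) x t) (at x)"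
proof -
  obtain K where K: "\<And>y s. y \<ge> x / 2 \<Longrightarrow> s > 0 \<Longrightarrow> q (\<beta> + 1) y s \<le> K" "K \<ge> 0"
    using q_bounded[of "\<beta> + 1" "x / 2"] assms by auto
  have "((\<lambda>x. \<integral>z. q \<beta> x (z * t powr \<nu>) * Q z \<partial>lborel) has_real_derivative
      (\<integral>z. - 2 * x * (q (\<beta> + 1) x (z * t powr \<nu>) * Q z) \<partial>lborel)) (at x)"
  proof (rule has_real_derivative_integral(2))
    show "x \<in> {x / 2<..<2 * x}" using assms by simp
    show "integrable lborel (\<lambda>z. q \<beta> y (z * t powr \<nu>) * Q z)" if "y \<in> {x / 2<..<2 * x}" for y
      using that assms by (intro V_integrable) auto
    show "((\<lambda>y. q \<beta> y (z * t powr \<nu>) * Q z) has_real_derivative - 2 * y * (q (\<beta> + 1) y (z * t powr \<nu>) * Q z)) (at y)" for y z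
      using DERIV_cmult_right[OF q_deriv_x[of "z * t powr \<nu>" \<beta> y], of "Q z"] assms
      by (cases "z > 0") (auto simp: Q_eq_0 mult.assoc)
    show "\<bar>- 2 * y * (q (\<beta> + 1) y (z * t powr \<nu>) * Q z)\<bar> \<le> 4 * x * (K * Q z)" if y: "y \<in> {x / 2<..<2 * x}" for y z
    proof -
      have "\<bar>q (\<beta> + 1) y (z * t powr \<nu>) * Q z\<bar> \<le> K * Q z"
        using y by (intro q_Q_bound K assms) auto
      then have "\<bar>- 2 * y\<bar> * \<bar>q (\<beta> + 1) y (z * t powr \<nu>) * Q z\<bar> \<le> (4 * x) * (K * Q z)"
        using y assms by (intro mult_mono) auto
      then show ?thesis by (simp only: abs_mult)
    qed
    show "integrable lborel (\<lambda>z. 4 * x * (K * Q z))" by (intro integrable_mult_right Q_integrable)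
  qed
  then show ?thesis by (simp only: V_def integral_mult_right_zero)
qed

lemma V_deriv_t:
  assumes \<beta>: "\<beta> > 0" and x: "x > 0" and t: "t > 0"
  shows "((\<lambda>t. t powr \<nu> * V (\<beta> + 1) x t) has_real_derivative
    \<nu> * t powr (\<nu> - 1) * (- \<beta> * V (\<beta> + 1) x t + x\<^sup>2 * V (\<beta> + 2) x t)) (at t)"
proof -
  obtain K1 where K1: "\<And>s. s > 0 \<Longrightarrow> q (\<beta> + 1) x s \<le> K1" "K1 \<ge> 0"
    using q_bounded[of "\<beta> + 1" x] \<beta> x by auto
  obtain K2 where K2: "\<And>s. s > 0 \<Longrightarrow> q (\<beta> + 2) x s \<le> K2" "K2 \<ge> 0"
    using q_bounded[of "\<beta> + 2" x] \<beta> x by auto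
  define f' where "f' r z = \<nu> * r powr (\<nu> - 1) * (- \<beta> * (q (\<beta> + 1) x (z * r powr \<nu>) * Q z) + x\<^sup>2 * (q (\<beta> + 2) x (z * r powr \<nu>) * Q z))" for r z
  have "((\<lambda>r. \<integral>z. r powr \<nu> * (q (\<beta> + 1) x (z * r powr \<nu>) * Q z) \<partial>lborel) has_real_derivative
      (\<integral>z. f' t z \<partial>lborel)) (at t)"
  proof (rule has_real_derivative_integral(2))
    show "t \<in> {t / 2<..<2 * t}" using t by simp
    show "integrable lborel (\<lambda>z. r powr \<nu> * (q (\<beta> + 1) x (z * r powr \<nu>) * Q z))" if "r \<in> {t / 2<..<2 * t}" for r
      using that t \<beta> x by (intro integrable_mult_right V_integrable) auto
    show "((\<lambda>r. r powr \<nu> * (q (\<beta> + 1) x (z * r powr \<nu>) * Q z)) has_real_derivative f' r z) (at r)"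
      if "r \<in> {t / 2<..<2 * t}" for r z
    proof (cases "z > 0")
      case False
      then show ?thesis by (simp add: Q_eq_0 f'_def)
    next
      case True
      have r: "r > 0" using that t by auto
      have "((\<lambda>r. z * r powr \<nu>) has_real_derivative z * (\<nu> * r powr (\<nu> - 1))) (at r)"
        by (intro DERIV_cmult has_real_derivative_powr r)
      with q_deriv_s[of "z * r powr \<nu>" \<beta> x] True r
      have "((\<lambda>r. q \<beta> x (z * r powr \<nu>)) has_real_derivative
          (- \<beta> * q (\<beta> + 1) x (z * r powr \<nu>) + x\<^sup>2 * q (\<beta> + 2) x (z * r powr \<nu>)) * (z * (\<nu> * r powr (\<nu> - 1)))) (at r)"
        by (intro DERIV_chain2[where f = "q \<beta> x"]) auto
      from DERIV_cmult_right[OF this, of "Q z / z"]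
      have "((\<lambda>r. q \<beta> x (z * r powr \<nu>) * (Q z / z)) has_real_derivative f' r z) (at r)"
      proof (rule DERIV_cong)
        show "(- \<beta> * q (\<beta> + 1) x (z * r powr \<nu>) + x\<^sup>2 * q (\<beta> + 2) x (z * r powr \<nu>)) * (z * (\<nu> * r powr (\<nu> - 1))) * (Q z / z) = f' r z"
          using True by (simp add: f'_def field_simps)
      qed
      moreover have "eventually (\<lambda>r. r powr \<nu> * (q (\<beta> + 1) x (z * r powr \<nu>) * Q z) = q \<beta> x (z * r powr \<nu>) * (Q z / z)) (nhds r)"
        using eventually_nhds_in_open[of "{0<..}" r] r True
        by (auto elim!: eventually_mono simp: q_shift[of _ \<beta>])
      ultimately show ?thesis by (subst DERIV_cong_ev[OF refl _ refl]) auto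
    qed
    show "\<bar>f' r z\<bar> \<le> \<nu> * (t / 2) powr (\<nu> - 1) * (\<beta> * (K1 * Q z) + x\<^sup>2 * (K2 * Q z))" if r: "r \<in> {t / 2<..<2 * t}" for r z
    proof -
      have r0: "r > 0" using r t by auto
      have b: "\<bar>q (\<beta> + 1) x (z * r powr \<nu>) * Q z\<bar> \<le> K1 * Q z" "\<bar>q (\<beta> + 2) x (z * r powr \<nu>) * Q z\<bar> \<le> K2 * Q z"
        by (intro q_Q_bound K1 K2 r0; assumption)+
      have "\<bar>- \<beta> * (q (\<beta> + 1) x (z * r powr \<nu>) * Q z) + x\<^sup>2 * (q (\<beta> + 2) x (z * r powr \<nu>) * Q z)\<bar>
          \<le> \<beta> * \<bar>q (\<beta> + 1) x (z * r powr \<nu>) * Q z\<bar> + x\<^sup>2 * \<bar>q (\<beta> + 2) x (z * r powr \<nu>) * Q z\<bar>"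
        by (rule order.trans[OF abs_triangle_ineq]) (use \<beta> in \<open>simp add: abs_mult\<close>)
      also have "\<dots> \<le> \<beta> * (K1 * Q z) + x\<^sup>2 * (K2 * Q z)"
        using \<beta> by (intro add_mono mult_left_mono b) auto
      finally have 1: "\<bar>- \<beta> * (q (\<beta> + 1) x (z * r powr \<nu>) * Q z) + x\<^sup>2 * (q (\<beta> + 2) x (z * r powr \<nu>) * Q z)\<bar> \<le> \<beta> * (K1 * Q z) + x\<^sup>2 * (K2 * Q z)" .
      have "r powr (\<nu> - 1) \<le> (t / 2) powr (\<nu> - 1)"
        using r t nu_less_1 by (intro powr_mono2') auto
      then have 2: "\<bar>\<nu> * r powr (\<nu> - 1)\<bar> \<le> \<nu> * (t / 2) powr (\<nu> - 1)" using nu_pos by (simp add: abs_mult)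
      show ?thesis unfolding f'_def abs_mult[of "\<nu> * r powr (\<nu> - 1)"]
        by (intro mult_mono 1 2) (use nu_pos in auto)
    qed
    show "integrable lborel (\<lambda>z. \<nu> * (t / 2) powr (\<nu> - 1) * (\<beta> * (K1 * Q z) + x\<^sup>2 * (K2 * Q z)))"
      by (intro integrable_mult_right Bochner_Integration.integrable_add Q_integrable)
  qed
  moreover have "(\<integral>z. f' t z \<partial>lborel) = \<nu> * t powr (\<nu> - 1) * (- \<beta> * V (\<beta> + 1) x t + x\<^sup>2 * V (\<beta> + 2) x t)"
  proof -
    have i: "integrable lborel (\<lambda>z. q (\<beta> + 1) x (z * t powr \<nu>) * Q z)" "integrable lborel (\<lambda>z. q (\<beta> + 2) x (z * t powr \<nu>) * Q z)"
      using \<beta> x t by (auto intro!: V_integrable)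
    show ?thesis unfolding f'_def V_def using i by simp
  qed
  ultimately show ?thesis by (simp only: V_def integral_mult_right_zero)
qed

lemma caputo_V:
  assumes \<beta>: "\<beta> > 0" and x: "x > 0" and t: "t > 0"
    and u: "\<And>r. r > 0 \<Longrightarrow> u r = k * (r powr \<nu> * V (\<beta> + 1) x r)"
  shows "caputo_differentiable \<nu> u t"
    and "caputo_deriv \<nu> u t = k * t powr \<nu> * (- \<beta> * V (\<beta> + 2) x t + x\<^sup>2 * V (\<beta> + 3) x t)"
proof -
  define \<psi> where "\<psi> s = - \<beta> * q (\<beta> + 2) x s + x\<^sup>2 * q (\<beta> + 3) x s" for s
  have cont: "continuous_on {0..} \<psi>" unfolding \<psi>_def
    using \<beta> x by (intro continuous_intros q_continuous_on) auto
  have "(\<psi> \<longlongrightarrow> - \<beta> * 0 + x\<^sup>2 * 0) at_top" unfolding \<psi>_def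
    using \<beta> by (intro tendsto_intros q_tendsto_0) auto
  then have lim: "(\<psi> \<longlongrightarrow> 0) at_top" by simp
  define D where "D r = r powr (\<nu> - 1) * (\<integral>z. z * r powr \<nu> * \<psi> (z * r powr \<nu>) * Q z \<partial>lborel)" for r
  note A = abel_integral_Q[OF t cont lim, folded D_def]
  have du: "(u has_real_derivative k * (\<nu> * D r)) (at r)" if r: "r > 0" for r
  proof -
    have "(\<integral>z. z * r powr \<nu> * \<psi> (z * r powr \<nu>) * Q z \<partial>lborel)
        = (\<integral>z. - \<beta> * (q (\<beta> + 1) x (z * r powr \<nu>) * Q z) + x\<^sup>2 * (q (\<beta> + 2) x (z * r powr \<nu>) * Q z) \<partial>lborel)"
    proof (intro Bochner_Integration.integral_cong refl)
      fix z
      show "z * r powr \<nu> * \<psi> (z * r powr \<nu>) * Q z = - \<beta> * (q (\<beta> + 1) x (z * r powr \<nu>) * Q z) + x\<^sup>2 * (q (\<beta> + 2) x (z * r powr \<nu>) * Q z)"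
      proof (cases "z > 0")
        case True
        then have s: "z * r powr \<nu> > 0" using r by simp
        show ?thesis using q_shift[OF s, of "\<beta> + 1" x] q_shift[OF s, of "\<beta> + 2" x]
          by (simp add: \<psi>_def algebra_simps)
      qed (simp add: Q_eq_0)
    qed
    also have "\<dots> = - \<beta> * V (\<beta> + 1) x r + x\<^sup>2 * V (\<beta> + 2) x r"
      unfolding V_def using V_integrable[of "\<beta> + 1" x r] V_integrable[of "\<beta> + 2" x r] \<beta> x r by simp
    finally have "\<nu> * D r = \<nu> * r powr (\<nu> - 1) * (- \<beta> * V (\<beta> + 1) x r + x\<^sup>2 * V (\<beta> + 2) x r)"
      by (simp add: D_def)
    then have "((\<lambda>r. k * (r powr \<nu> * V (\<beta> + 1) x r)) has_real_derivative k * (\<nu> * D r)) (at r)"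
      using V_deriv_t[OF \<beta> x r] by (intro DERIV_cmult) (simp only:)
    moreover have "eventually (\<lambda>r. u r = k * (r powr \<nu> * V (\<beta> + 1) x r)) (nhds r)"
      using eventually_nhds_in_open[of "{0<..}" r] r by (auto elim!: eventually_mono simp: u)
    ultimately show ?thesis by (subst DERIV_cong_ev[OF refl _ refl]) auto
  qed
  have eq: "indicat_real {0<..<t} r *\<^sub>R ((t - r) powr (- \<nu>) * deriv u r)
      = k * \<nu> * (indicat_real {0<..<t} r *\<^sub>R ((t - r) powr (- \<nu>) * D r))" for r
    using DERIV_imp_deriv[OF du[of r]] by (auto simp: indicator_def)
  have "set_integrable lborel {0<..<t} (\<lambda>r. (t - r) powr (- \<nu>) * deriv u r)"
    unfolding set_integrable_def eq using A(1) by (intro integrable_mult_right) (simp add: set_integrable_def)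
  then show "caputo_differentiable \<nu> u t"
    using nu_less_1 du by (force simp: caputo_differentiable_def real_differentiable_def)
  have "(LBINT r:{0<..<t}. (t - r) powr (- \<nu>) * deriv u r) = k * \<nu> * (LBINT r:{0<..<t}. (t - r) powr (- \<nu>) * D r)"
    unfolding set_lebesgue_integral_def eq by (rule integral_mult_right_zero)
  also have "\<dots> = k * Gamma (1 - \<nu>) * t powr \<nu> * (\<integral>z. \<psi> (z * t powr \<nu>) * Q z \<partial>lborel)"
    unfolding A(2) using nu_pos by simp
  also have "(\<integral>z. \<psi> (z * t powr \<nu>) * Q z \<partial>lborel)
      = (\<integral>z. - \<beta> * (q (\<beta> + 2) x (z * t powr \<nu>) * Q z) + x\<^sup>2 * (q (\<beta> + 3) x (z * t powr \<nu>) * Q z) \<partial>lborel)"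
    by (intro Bochner_Integration.integral_cong refl) (simp add: \<psi>_def algebra_simps)
  also have "\<dots> = - \<beta> * V (\<beta> + 2) x t + x\<^sup>2 * V (\<beta> + 3) x t"
    unfolding V_def using V_integrable[of "\<beta> + 2" x t] V_integrable[of "\<beta> + 3" x t] \<beta> x t by simp
  finally have "(LBINT r:{0<..<t}. (t - r) powr (- \<nu>) * deriv u r)
      = k * Gamma (1 - \<nu>) * t powr \<nu> * (- \<beta> * V (\<beta> + 2) x t + x\<^sup>2 * V (\<beta> + 3) x t)" .
  moreover have "Gamma (1 - \<nu>) \<noteq> 0" using Gamma_real_pos[of "1 - \<nu>"] nu_less_1 by fastforce
  ultimately show "caputo_deriv \<nu> u t = k * t powr \<nu> * (- \<beta> * V (\<beta> + 2) x t + x\<^sup>2 * V (\<beta> + 3) x t)"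
    using nu_less_1 by (simp add: caputo_deriv_def)
qed

lemma u_tilde_eq:
  assumes l: "\<And>s t. s > 0 \<Longrightarrow> t > 0 \<Longrightarrow> inverse_density h s t = Pd 0 (s * t powr (- \<nu>)) / (\<nu> * s)"
    and \<mu>: "\<mu> > 0" and x: "x > 0" and t: "t > 0"
  shows "set_integrable lborel {0<..} (\<lambda>s. g_tilde \<mu> x s * inverse_density h s t)"
    and "u_tilde \<mu> \<nu> h x t = 2 / (Gamma \<mu> * \<nu>) * x powr (2 * \<mu> - 1) * (t powr \<nu> * V (\<mu> + 1) x t)"
proof -
  define c where "c = 2 / (Gamma \<mu> * \<nu>) * x powr (2 * \<mu> - 1)"
  define F where "F s = q (\<mu> + 1) x s * Q (s * t powr (- \<nu>))" for s
  have T: "t powr \<nu> > 0" using t by simp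
  have eq: "indicat_real {0<..} s *\<^sub>R (g_tilde \<mu> x s * inverse_density h s t) = c * F s" for s
  proof (cases "s > 0")
    case True
    then show ?thesis using t by (simp add: g_tilde_eq l q_shift[of s \<mu>] c_def F_def Q_def)
  next
    case False
    then show ?thesis using t by (simp add: F_def Q_def zero_less_mult_iff)
  qed
  have Fa: "F (0 + t powr \<nu> * z) = q (\<mu> + 1) x (z * t powr \<nu>) * Q z" for z
  proof -
    have "t powr \<nu> * z * t powr (- \<nu>) = z" using t by (simp add: powr_minus)
    then have "F (0 + t powr \<nu> * z) = q (\<mu> + 1) x (t powr \<nu> * z) * Q z"
      by (simp only: F_def add_0)
    then show ?thesis by (simp only: mult.commute[of z])
  qed
  have "integrable lborel (\<lambda>z. F (0 + t powr \<nu> * z))"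
    unfolding Fa using \<mu> x t by (intro V_integrable) auto
  then have iF: "integrable lborel F"
    using T by (subst (asm) lborel_integrable_real_affine_iff) auto
  show "set_integrable lborel {0<..} (\<lambda>s. g_tilde \<mu> x s * inverse_density h s t)"
    unfolding set_integrable_def eq using iF by simp
  have "u_tilde \<mu> \<nu> h x t = c * (\<integral>s. F s \<partial>lborel)"
    using nu_less_1 unfolding u_tilde_def set_lebesgue_integral_def eq by simp
  also have "(\<integral>s. F s \<partial>lborel) = t powr \<nu> * V (\<mu> + 1) x t"
    using T by (subst lborel_integral_real_affine[of "t powr \<nu>" _ 0]) (simp_all only: Fa V_def, auto)
  finally show "u_tilde \<mu> \<nu> h x t = 2 / (Gamma \<mu> * \<nu>) * x powr (2 * \<mu> - 1) * (t powr \<nu> * V (\<mu> + 1) x t)"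
    by (simp add: c_def)
qed

lemma solves_fractional_equation_u_tilde:
  assumes l: "\<And>s t. s > 0 \<Longrightarrow> t > 0 \<Longrightarrow> inverse_density h s t = Pd 0 (s * t powr (- \<nu>)) / (\<nu> * s)"
    and \<mu>: "\<mu> > 0"
  shows "solves_fractional_equation \<mu> \<nu> (u_tilde \<mu> \<nu> h)"
  unfolding solves_fractional_equation_def
proof (intro allI impI)
  fix x t :: real assume x: "x > 0" and t: "t > 0"
  have u: "u_tilde \<mu> \<nu> h x t = 2 / (Gamma \<mu> * \<nu>) * x powr (2 * \<mu> - 1) * (t powr \<nu> * V (\<mu> + 1) x t)"
    if "x > 0" "t > 0" for x t
    by (rule u_tilde_eq(2)) (use l \<mu> that in auto)
  note C = caputo_V[OF \<mu> x t u[OF x], simplified]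
  define k where "k = 2 / (Gamma \<mu> * \<nu>) * t powr \<nu>"
  have uy: "u_tilde \<mu> \<nu> h y t = k * (y powr (2 * \<mu> - 1) * V (\<mu> + 1) y t)" if "y > 0" for y
    using u[OF that t] by (simp add: k_def)
  have d: "((\<lambda>y. V (\<mu> + 1) y t) has_real_derivative - 2 * y * V (\<mu> + 2) y t) (at y)"
      "((\<lambda>y. V (\<mu> + 2) y t) has_real_derivative - 2 * y * V (\<mu> + 3) y t) (at y)" if "y > 0" for y
    using V_deriv_x[OF _ that t, of "\<mu> + 1"] V_deriv_x[OF _ that t, of "\<mu> + 2"] \<mu> by (simp_all add: add.assoc)
  note B = bessel_operator_identity[of "\<lambda>y. u_tilde \<mu> \<nu> h y t", OF uy d x, simplified]
  show "caputo_differentiable \<nu> (\<lambda>r. u_tilde \<mu> \<nu> h x r) t \<and>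
      (\<lambda>y. u_tilde \<mu> \<nu> h y t) differentiable (at x) \<and>
      deriv (\<lambda>y. u_tilde \<mu> \<nu> h y t) differentiable (at x) \<and>
      caputo_deriv \<nu> (\<lambda>r. u_tilde \<mu> \<nu> h x r) t =
      1 / 2 ^ 2 * (deriv (deriv (\<lambda>y. u_tilde \<mu> \<nu> h y t)) x - deriv (\<lambda>y. (2 * \<mu> - 1) / y * u_tilde \<mu> \<nu> h y t) x)"
    using B C by (simp add: k_def)
qed

end

lemma solves_fractional_equation_u_tilde_1:
  "solves_fractional_equation \<mu> 1 (u_tilde \<mu> 1 h)"
  unfolding solves_fractional_equation_def
proof (intro allI impI)
  fix x t :: real assume x: "x > 0" and t: "t > 0"
  have u: "u_tilde \<mu> 1 h x t = 2 / Gamma \<mu> * x powr (2 * \<mu> - 1) * q \<mu> x t" for x t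
  proof -
    have "g_tilde \<mu> x \<in> borel_measurable borel" unfolding g_tilde_def[abs_def] by measurable
    then have "u_tilde \<mu> 1 h x t = g_tilde \<mu> x t" by (simp add: u_tilde_def integral_return)
    then show ?thesis by (simp add: g_tilde_eq)
  qed
  have dt: "((\<lambda>r. u_tilde \<mu> 1 h x r) has_real_derivative
      2 / Gamma \<mu> * x powr (2 * \<mu> - 1) * (- \<mu> * q (\<mu> + 1) x t + x\<^sup>2 * q (\<mu> + 2) x t)) (at t)"
    unfolding u by (intro DERIV_cmult q_deriv_s t)
  have uy: "u_tilde \<mu> 1 h y t = 2 / Gamma \<mu> * (y powr (2 * \<mu> - 1) * q \<mu> y t)" for y
    by (simp add: u)
  have d: "((\<lambda>y. q \<mu> y t) has_real_derivative - 2 * y * q (\<mu> + 1) y t) (at y)"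
      "((\<lambda>y. q (\<mu> + 1) y t) has_real_derivative - 2 * y * q (\<mu> + 2) y t) (at y)" for y
    using q_deriv_x[OF t, of \<mu> y] q_deriv_x[OF t, of "\<mu> + 1" y] by (simp_all add: add.assoc)
  note B = bessel_operator_identity[of "\<lambda>y. u_tilde \<mu> 1 h y t", OF uy d x, simplified]
  show "caputo_differentiable 1 (\<lambda>r. u_tilde \<mu> 1 h x r) t \<and>
      (\<lambda>y. u_tilde \<mu> 1 h y t) differentiable (at x) \<and>
      deriv (\<lambda>y. u_tilde \<mu> 1 h y t) differentiable (at x) \<and>
      caputo_deriv 1 (\<lambda>r. u_tilde \<mu> 1 h x r) t =
      1 / 2 ^ 2 * (deriv (deriv (\<lambda>y. u_tilde \<mu> 1 h y t)) x - deriv (\<lambda>y. (2 * \<mu> - 1) / y * u_tilde \<mu> 1 h y t) x)"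
    using B dt DERIV_imp_deriv[OF dt]
    by (auto simp: caputo_differentiable_def caputo_deriv_def real_differentiable_def)
qed

theorem corollary3:
  fixes \<mu> \<nu> :: real
    and M :: "'a measure" and \<tau> :: "real \<Rightarrow> 'a \<Rightarrow> real" and h :: "real \<Rightarrow> real \<Rightarrow> real"
  assumes "\<mu> > 0" and "0 < \<nu>" and "\<nu> \<le> 1"
    and "\<nu> < 1 \<Longrightarrow> stable_subordinator \<nu> M \<tau>"
    and "\<nu> < 1 \<Longrightarrow> continuous_density_of M \<tau> h"
  shows "(\<nu> < 1 \<longrightarrow> (\<forall>x>0. \<forall>t>0.
            set_integrable lborel {0<..} (\<lambda>s. g_tilde \<mu> x s * inverse_density h s t)))
         \<and> solves_fractional_equation \<mu> \<nu> (u_tilde \<mu> \<nu> h)"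
proof (cases "\<nu> < 1")
  case False
  then have "\<nu> = 1" using assms(3) by simp
  then show ?thesis using solves_fractional_equation_u_tilde_1 by simp
next
  case True
  interpret stable_index \<nu> using assms(2) True by unfold_locales
  have h: "h s x = Pd 0 (x * s powr (- \<nu>)) / s" if "s > 0" "x > 0" for s x
    using density_eq[OF assms(4,5)[OF True] that(2,1)] .
  interpret stable_positive \<nu>
  proof
    fix w :: real assume w: "w > 0"
    have "h 1 w \<ge> 0" using assms(5)[OF True] w by (auto simp: continuous_density_of_def)
    then show "Pd 0 w \<ge> 0" using h[of 1 w] w by simp
  qed
  have l: "inverse_density h s t = Pd 0 (s * t powr (- \<nu>)) / (\<nu> * s)" if "s > 0" "t > 0" for s t
    by (rule inverse_density_eq) (use h that in auto)
  have "set_integrable lborel {0<..} (\<lambda>s. g_tilde \<mu> x s * inverse_density h s t)" if "x > 0" "t > 0" for x t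
    by (rule u_tilde_eq(1)) (use l assms(1) that in auto)
  moreover have "solves_fractional_equation \<mu> \<nu> (u_tilde \<mu> \<nu> h)"
    by (rule solves_fractional_equation_u_tilde) (use l assms(1) in auto)
  ultimately show ?thesis by blast
qed

end
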